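(* Let $q\ge2$ and $p\le2$ (with $p,q\in[1,\infty]$), and let $\gamma>1$ be a constant. If for each $n$, $(\mathcal{S},f)$ is a $(k(n),\gamma)$-sketching family for the $q\to p$ norm of $n\times n$ real matrices, then $k(n)=\Omega(n^2)$.
   Context: $\|A\|_{q\to p}=\sup_{x\ne0}\frac{\|Ax\|_p}{\|x\|_q}$. A $(k,\alpha)$-sketching family for the $q\to p$ norm is a pair $(\mathcal{S},f)$ where $\mathcal{S}$ is a distribution over linear maps $L:\mathbb{R}^{n\times n}\to\mathbb{R}^k$ and $f:\mathbb{R}^k\to\mathbb{R}$, such that for every $A$, $\Pr_{L\sim\mathcal{S}}\big[f(L(A))\in(\tfrac1\alpha\|A\|_{q\to p},\,\alpha\|A\|_{q\to p})\big]\ge \frac56$. *)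

theory Defs
  imports "HOL-Probability.Probability" "HOL-Library.Landau_Symbols"
begin

text \<open>
  The space of real vectors indexed by a finite set \<open>I\<close> is \<open>I \<rightarrow>\<^sub>E UNIV\<close>, with the Borel sets
  \<open>\<Pi>\<^sub>M i\<in>I. borel\<close>. Vectors of length \<open>n\<close> are indexed by \<open>{..<n}\<close> and
  \<open>n\<close> by \<open>n\<close> matrices by \<open>{..<n} \<times> {..<n}\<close>, with \<open>A (i, j)\<close> the entry in row \<open>i\<close>, column \<open>j\<close>.
\<close>

definition lp_norm :: "ereal \<Rightarrow> 'i set \<Rightarrow> ('i \<Rightarrow> real) \<Rightarrow> real" where
  "lp_norm p I x =
     (if p = \<infinity> then Max ((\<lambda>i. \<bar>x i\<bar>) ` I)
      else (\<Sum>i\<in>I. \<bar>x i\<bar> powr real_of_ereal p) powr (1 / real_of_ereal p))"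

definition mat_vec :: "nat \<Rightarrow> (nat \<times> nat \<Rightarrow> real) \<Rightarrow> (nat \<Rightarrow> real) \<Rightarrow> nat \<Rightarrow> real" where
  "mat_vec n A x = (\<lambda>i\<in>{..<n}. \<Sum>j<n. A (i, j) * x j)"

text \<open>For \<open>n \<ge> 1\<close> and \<open>p, q \<ge> 1\<close> the supremum is over a nonempty bounded set of reals.\<close>

definition op_norm :: "ereal \<Rightarrow> ereal \<Rightarrow> nat \<Rightarrow> (nat \<times> nat \<Rightarrow> real) \<Rightarrow> real" where
  "op_norm q p n A =
     (SUP x\<in>{x \<in> {..<n} \<rightarrow>\<^sub>E UNIV. \<exists>i<n. x i \<noteq> 0}.
        lp_norm p {..<n} (mat_vec n A x) / lp_norm q {..<n} x)"

definition linear_maps :: "'i set \<Rightarrow> 'j set \<Rightarrow> (('i \<Rightarrow> real) \<Rightarrow> 'j \<Rightarrow> real) set" where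
  "linear_maps I J =
     {L \<in> (I \<rightarrow>\<^sub>E UNIV) \<rightarrow>\<^sub>E (J \<rightarrow>\<^sub>E UNIV).
        \<forall>x\<in>I \<rightarrow>\<^sub>E UNIV. \<forall>y\<in>I \<rightarrow>\<^sub>E UNIV. \<forall>a b. \<forall>j\<in>J.
          L (\<lambda>i\<in>I. a * x i + b * y i) j = a * L x j + b * L y j}"

text \<open>
  The \<open>\<sigma>\<close>-algebra generated by the evaluations \<open>L \<mapsto> L x\<close>. For finite \<open>I\<close> and \<open>J\<close> it is the Borel
  \<open>\<sigma>\<close>-algebra of the finite-dimensional space of linear maps. (The measure that the expression
  carries is irrelevant; only its sets are used.)
\<close>

definition linear_map_borel ::
    "'i set \<Rightarrow> 'j set \<Rightarrow> (('i \<Rightarrow> real) \<Rightarrow> 'j \<Rightarrow> real) measure" where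
  "linear_map_borel I J =
     restrict_space (\<Pi>\<^sub>M x\<in>I \<rightarrow>\<^sub>E UNIV. \<Pi>\<^sub>M j\<in>J. borel) (linear_maps I J)"

text \<open>
  A distribution over linear maps is a Borel probability measure, and \<open>f\<close> is Borel measurable, so
  that the probabilities are defined. The accuracy requirement is imposed for \<open>A \<noteq> 0\<close> only: for
  \<open>A = 0\<close> the open interval is empty and no pair \<open>(S, f)\<close> could meet it.
\<close>

definition sketching_family ::
    "ereal \<Rightarrow> ereal \<Rightarrow> nat \<Rightarrow> nat \<Rightarrow> real \<Rightarrow>
     ((nat \<times> nat \<Rightarrow> real) \<Rightarrow> nat \<Rightarrow> real) measure \<Rightarrow> ((nat \<Rightarrow> real) \<Rightarrow> real) \<Rightarrow> bool" where
  "sketching_family q p n k \<alpha> S f \<longleftrightarrow>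
     prob_space S \<and>
     sets S = sets (linear_map_borel ({..<n} \<times> {..<n}) {..<k}) \<and>
     f \<in> borel_measurable (\<Pi>\<^sub>M i\<in>{..<k}. borel) \<and>
     (\<forall>A \<in> {..<n} \<times> {..<n} \<rightarrow>\<^sub>E UNIV. (\<exists>i<n. \<exists>j<n. A (i, j) \<noteq> 0) \<longrightarrow>
        measure S {L \<in> space S. f (L A) \<in> {1 / \<alpha> * op_norm q p n A <..< \<alpha> * op_norm q p n A}}
          \<ge> 5 / 6)"

end

theory Submission
  imports Defs
begin

text \<open>
  Write \<open>I = {..<n}\<close>. The hard instance is to tell a standard Gaussian matrix \<open>G\<close> from
  \<open>G + \<sigma> u v\<^sup>T\<close>, where \<open>u\<close> and \<open>v\<close> are independent uniform sign vectors and
  \<open>\<sigma> = C / sqrt n\<close> with \<open>C = 20 (1 + \<gamma>\<^sup>2)\<close>. With probability at least \<open>14 / 15\<close> the Euclidean operator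
  norm of \<open>G\<close> is at most \<open>20 sqrt n\<close>. As \<open>p \<le> 2 \<le> q\<close>, normalised \<open>\<ell>\<^sub>p\<close> norms increase with
  \<open>p\<close>, so up to the common factor \<open>n powr (1 / p - 1 / q)\<close> the \<open>q \<rightarrow> p\<close> norm of \<open>G\<close> is at
  most \<open>20 sqrt n\<close>, while that of \<open>G + \<sigma> u v\<^sup>T\<close>, tested on \<open>v\<close>, is at least
  \<open>(C - 20) sqrt n = 20 \<gamma>\<^sup>2 sqrt n\<close>. A \<open>\<gamma>\<close>-accurate sketch must therefore distinguish the two.

  A sketch with \<open>k\<close> rows sees only the orthogonal projection \<open>Z\<close> of \<open>u v\<^sup>T\<close> to a space of dimension
  at most \<open>k\<close>. The expectation of \<open>\<bar>Z\<bar>\<^sup>2\<close> is at most \<open>k\<close>, so if \<open>k\<close> is a small multiple of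
  \<open>n\<^sup>2\<close>, then \<open>\<sigma>\<^sup>4 \<bar>Z\<bar>\<^sup>2\<close> is small for most \<open>(u, v)\<close>. Restricting the mixture to these
  pairs, the second moment of the likelihood ratio is an average of
  \<open>exp (\<sigma>\<^sup>2 \<langle>Z, Z'\<rangle>) = exp (\<sigma>\<^sup>2 u'\<^sup>T Z v')\<close>. For fixed \<open>Z\<close> the average over all
  \<open>(u', v')\<close> is close to \<open>1\<close>, since a bilinear sign chaos whose matrix has small Frobenius norm has
  exponential moment close to \<open>1\<close>. So the sketch cannot distinguish the two distributions.
\<close>

section \<open>Sign vectors\<close>

definition sign_vectors :: "'i set \<Rightarrow> ('i \<Rightarrow> real) set" where
  "sign_vectors I = I \<rightarrow>\<^sub>E {-1, 1}"

lemma finite_sign_vectors: "finite I \<Longrightarrow> finite (sign_vectors I)"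
  unfolding sign_vectors_def by (rule finite_PiE) auto

lemma card_sign_vectors: "finite I \<Longrightarrow> card (sign_vectors I) = 2 ^ card I"
  unfolding sign_vectors_def by (simp add: card_PiE numeral_2_eq_2)

lemma sign_vectors_cases: "u \<in> sign_vectors I \<Longrightarrow> i \<in> I \<Longrightarrow> u i = -1 \<or> u i = 1"
  unfolding sign_vectors_def by (auto simp: PiE_iff)

lemma sign_vectors_square: "u \<in> sign_vectors I \<Longrightarrow> i \<in> I \<Longrightarrow> u i * u i = 1"
  using sign_vectors_cases by fastforce

lemma sign_vectors_abs: "u \<in> sign_vectors I \<Longrightarrow> i \<in> I \<Longrightarrow> \<bar>u i\<bar> = 1"
  using sign_vectors_cases by fastforce

lemma sum_sign_vectors_empty: "(\<Sum>u\<in>sign_vectors {}. F u) = F (\<lambda>_. undefined)"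
  by (simp add: sign_vectors_def)

lemma sum_sign_vectors_insert:
  fixes F :: "('i \<Rightarrow> real) \<Rightarrow> real"
  assumes "finite I" "i \<notin> I"
  shows "(\<Sum>u\<in>sign_vectors (insert i I). F u) = (\<Sum>u\<in>sign_vectors I. F (u(i := 1)) + F (u(i := -1)))"
proof -
  have "(\<Sum>u\<in>sign_vectors (insert i I). F u)
      = (\<Sum>(y, g)\<in>{-1, 1} \<times> sign_vectors I. F (g(i := y)))"
    unfolding sign_vectors_def PiE_insert_eq
    by (subst sum.reindex[OF inj_combinator[OF assms(2)]]) (simp add: case_prod_unfold)
  also have "\<dots> = (\<Sum>y\<in>{-1, 1}. \<Sum>g\<in>sign_vectors I. F (g(i := y)))"
    by (rule sum.cartesian_product[symmetric])
  finally show ?thesis by (simp add: sum.distrib add.commute)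
qed

text \<open>This is cosh y <= exp (y^2 / 2), the subgaussian bound for a fair sign: Hoeffding's
  inequality - h / 2 + ln ((1 + exp h) / 2) <= h^2 / 8 at h = 2 y, used for y >= 0 and extended by
  evenness.\<close>

lemma exp_add_exp_minus_le:
  fixes y :: real
  shows "exp y + exp (- y) \<le> 2 * exp (y\<^sup>2 / 2)"
proof -
  have *: "exp y + exp (- y) \<le> 2 * exp (y\<^sup>2 / 2)" if "y \<ge> 0" for y :: real
  proof -
    have pos: "(1 + exp (2 * y)) / 2 > 0" by (simp add: add_pos_pos)
    have "- y + ln ((1 + exp (2 * y)) / 2) \<le> y\<^sup>2 / 2"
      using Hoeffdings_lemma_aux[of "2 * y" "1 / 2"] that by (simp add: power_mult_distrib field_simps)
    hence "exp (- y + ln ((1 + exp (2 * y)) / 2)) \<le> exp (y\<^sup>2 / 2)" by simp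
    also have "exp (- y + ln ((1 + exp (2 * y)) / 2)) = exp (- y) * ((1 + exp (2 * y)) / 2)"
      using pos by (simp only: exp_add exp_ln)
    also have "\<dots> = (exp y + exp (- y)) / 2"
      by (simp add: algebra_simps add_divide_distrib exp_add[symmetric])
    finally show ?thesis by simp
  qed
  show ?thesis
  proof (cases "y \<ge> 0")
    case False
    thus ?thesis using *[of "- y"] by (simp add: add.commute)
  qed (rule *)
qed

section \<open>Moments and exponential moments of sign sums\<close>

lemma sum_upd_notin:
  assumes "i \<notin> I"
  shows "(\<Sum>k\<in>I. (u(i := c)) k * b k) = (\<Sum>k\<in>I. u k * (b k :: real))"
  using assms by (intro sum.cong) auto

text \<open>Distinct signs are uncorrelated: in the induction the two values of the new sign cancel
  the cross term, (w + c)^2 + (w - c)^2 = 2 w^2 + 2 c^2.\<close>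

lemma sum_sign_vectors_linear_square:
  assumes "finite I"
  shows "(\<Sum>u\<in>sign_vectors I. (\<Sum>i\<in>I. u i * c i)\<^sup>2) = 2 ^ card I * (\<Sum>i\<in>I. (c i)\<^sup>2)"
  using assms
proof (induction I rule: finite_induct)
  case (insert i I)
  have "(\<Sum>u\<in>sign_vectors (insert i I). (\<Sum>k\<in>insert i I. u k * c k)\<^sup>2)
      = (\<Sum>u\<in>sign_vectors I. 2 * (\<Sum>k\<in>I. u k * c k)\<^sup>2 + 2 * (c i)\<^sup>2)"
    by (subst sum_sign_vectors_insert[OF insert.hyps], intro sum.cong refl)
       (simp add: insert.hyps sum_upd_notin del: fun_upd_apply, simp add: power2_eq_square algebra_simps)
  also have "\<dots> = 2 * (\<Sum>u\<in>sign_vectors I. (\<Sum>k\<in>I. u k * c k)\<^sup>2) + 2 ^ card I * (2 * (c i)\<^sup>2)"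
    by (simp add: sum.distrib card_sign_vectors insert.hyps sum_distrib_left)
  finally show ?case using insert by (simp add: algebra_simps)
qed (simp add: sum_sign_vectors_empty)

text \<open>Independence of the signs factorises the sum, and each factor is bounded by
  \<open>exp_add_exp_minus_le\<close>.\<close>

lemma sum_sign_vectors_exp_linear:
  assumes "finite I"
  shows "(\<Sum>u\<in>sign_vectors I. exp (\<Sum>i\<in>I. u i * c i)) \<le> 2 ^ card I * exp ((\<Sum>i\<in>I. (c i)\<^sup>2) / 2)"
  using assms
proof (induction I rule: finite_induct)
  case (insert i I)
  have "(\<Sum>u\<in>sign_vectors (insert i I). exp (\<Sum>k\<in>insert i I. u k * c k))
      = (\<Sum>u\<in>sign_vectors I. exp (\<Sum>k\<in>I. u k * c k)) * (exp (c i) + exp (- c i))"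
    unfolding sum_distrib_right
    by (subst sum_sign_vectors_insert[OF insert.hyps], intro sum.cong refl)
       (simp add: insert.hyps sum_upd_notin del: fun_upd_apply, simp add: exp_add exp_diff exp_minus field_simps)
  also have "\<dots> \<le> (2 ^ card I * exp ((\<Sum>i\<in>I. (c i)\<^sup>2) / 2)) * (2 * exp ((c i)\<^sup>2 / 2))"
    by (intro mult_mono insert.IH exp_add_exp_minus_le) auto
  finally show ?case using insert.hyps by (simp add: exp_add[symmetric] add_divide_distrib algebra_simps)
qed (simp add: sum_sign_vectors_empty sign_vectors_def)

text \<open>Averaging out one sign turns the coefficient \<open>a\<close> into at most \<open>a / (1 - 2 * a * \<bar>b i\<bar>\<^sup>2)\<close>,
  that is, \<open>1 / a\<close> decreases by at most \<open>2 * \<bar>b i\<bar>\<^sup>2\<close>; this is what makes the induction close.\<close>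

lemma sum_sign_vectors_exp_square:
  fixes b :: "'i \<Rightarrow> 'j \<Rightarrow> real"
  assumes "finite I" "0 \<le> a" "2 * a * (\<Sum>i\<in>I. \<Sum>j\<in>J. (b i j)\<^sup>2) < 1"
  shows "(\<Sum>u\<in>sign_vectors I. exp (a * (\<Sum>j\<in>J. (\<Sum>i\<in>I. u i * b i j)\<^sup>2)))
    \<le> 2 ^ card I * exp (a * (\<Sum>i\<in>I. \<Sum>j\<in>J. (b i j)\<^sup>2) / (1 - 2 * a * (\<Sum>i\<in>I. \<Sum>j\<in>J. (b i j)\<^sup>2)))"
  using assms
proof (induction I arbitrary: a rule: finite_induct)
  case (insert i I)
  define B t where "B = (\<Sum>i\<in>I. \<Sum>j\<in>J. (b i j)\<^sup>2)" and "t = (\<Sum>j\<in>J. (b i j)\<^sup>2)"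
  have nn: "B \<ge> 0" "t \<ge> 0" by (auto simp: B_def t_def intro!: sum_nonneg)
  have Bt: "(\<Sum>i\<in>insert i I. \<Sum>j\<in>J. (b i j)\<^sup>2) = t + B"
    using insert.hyps by (simp add: B_def t_def)
  have lt: "2 * a * (t + B) < 1" using insert.prems Bt by simp
  \<comment> \<open>With d and W as in \<open>step\<close>, the two values of the new sign give a
    factor cosh (2 a d) <= exp (2 a^2 d^2), and d^2 <= W t by Cauchy-Schwarz. This raises the
    coefficient of W by 2 a^2 t.\<close>
  define a' where "a' = a + 2 * a\<^sup>2 * t"
  have a0: "0 \<le> a" by fact
  have at: "2 * a * t < 1" "0 \<le> a * t" "0 \<le> a * B"
    using lt a0 nn by (auto simp: algebra_simps intro: le_less_trans[of _ "a*t*2 + a*B*2"] add_increasing)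
  have a'0: "0 \<le> a'" using a0 nn by (simp add: a'_def)
  \<comment> \<open>Here (1 + 2 a t) (1 - 2 a t) <= 1; this is 1 / a' >= 1 / a - 2 t in a form free
    of division.\<close>
  have a'le: "a' * (1 - 2 * a * t) \<le> a"
    using a0 nn by (simp add: a'_def algebra_simps power2_eq_square)
  have a'B: "2 * a' * B < 1"
  proof -
    have "2 * a' * B * (1 - 2 * a * t) \<le> 2 * a * B"
      using mult_right_mono[OF a'le, of "2 * B"] nn by (simp add: algebra_simps)
    also have "\<dots> < 1 * (1 - 2 * a * t)" using lt by (simp add: algebra_simps)
    finally show ?thesis using at by (simp add: mult_less_cancel_right)
  qed
  have step: "exp (a * (\<Sum>j\<in>J. (w j + b i j)\<^sup>2)) + exp (a * (\<Sum>j\<in>J. (w j - b i j)\<^sup>2))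
    \<le> 2 * exp (a * t) * exp (a' * (\<Sum>j\<in>J. (w j)\<^sup>2))" for w
  proof -
    define W d where "W = (\<Sum>j\<in>J. (w j)\<^sup>2)" and "d = (\<Sum>j\<in>J. w j * b i j)"
    have e: "(\<Sum>j\<in>J. (w j + b i j)\<^sup>2) = W + t + 2 * d" "(\<Sum>j\<in>J. (w j - b i j)\<^sup>2) = W + t - 2 * d"
      by (simp_all add: W_def t_def d_def power2_eq_square algebra_simps sum.distrib sum_subtractf sum_distrib_left)
    have "d\<^sup>2 \<le> W * t" unfolding d_def W_def t_def by (rule Cauchy_Schwarz_ineq_sum)
    hence "(2 * a * d)\<^sup>2 / 2 \<le> 2 * a\<^sup>2 * (W * t)"
      using mult_left_mono[of "d\<^sup>2" "W * t" "2 * a\<^sup>2"] by (simp add: power_mult_distrib)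
    hence "exp (2 * a * d) + exp (- (2 * a * d)) \<le> 2 * exp (2 * a\<^sup>2 * (W * t))"
      using exp_add_exp_minus_le[of "2 * a * d"] by (smt (verit) exp_le_cancel_iff)
    hence "exp (a * (W + t)) * (exp (2 * a * d) + exp (- (2 * a * d))) \<le> exp (a * (W + t)) * (2 * exp (2 * a\<^sup>2 * (W * t)))"
      by (rule mult_left_mono) simp
    thus ?thesis unfolding e W_def[symmetric] a'_def
      by (simp add: exp_add[symmetric] algebra_simps)
  qed
  have "(\<Sum>u\<in>sign_vectors (insert i I). exp (a * (\<Sum>j\<in>J. (\<Sum>k\<in>insert i I. u k * b k j)\<^sup>2)))
      = (\<Sum>u\<in>sign_vectors I. exp (a * (\<Sum>j\<in>J. ((\<Sum>k\<in>I. u k * b k j) + b i j)\<^sup>2))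
          + exp (a * (\<Sum>j\<in>J. ((\<Sum>k\<in>I. u k * b k j) - b i j)\<^sup>2)))"
    by (subst sum_sign_vectors_insert[OF insert.hyps], intro sum.cong refl)
       (simp add: insert.hyps sum_upd_notin del: fun_upd_apply, simp add: algebra_simps)
  also have "\<dots> \<le> (\<Sum>u\<in>sign_vectors I. 2 * exp (a * t) * exp (a' * (\<Sum>j\<in>J. (\<Sum>k\<in>I. u k * b k j)\<^sup>2)))"
    by (intro sum_mono step)
  also have "\<dots> = 2 * exp (a * t) * (\<Sum>u\<in>sign_vectors I. exp (a' * (\<Sum>j\<in>J. (\<Sum>k\<in>I. u k * b k j)\<^sup>2)))"
    by (simp add: sum_distrib_left)
  also have "\<dots> \<le> 2 * exp (a * t) * (2 ^ card I * exp (a' * B / (1 - 2 * a' * B)))"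
    using insert.IH[OF a'0] a'B by (intro mult_left_mono) (simp_all add: B_def)
  also have "\<dots> = 2 ^ card (insert i I) * exp (a * t + a' * B / (1 - 2 * a' * B))"
    using insert.hyps by (simp add: exp_add)
  \<comment> \<open>Both summands are brought to the final denominator. For the fraction, the common
    term 2 a a' B cancels and \<open>a'le\<close> remains.\<close>
  also have "a * t + a' * B / (1 - 2 * a' * B) \<le> a * (t + B) / (1 - 2 * a * (t + B))"
  proof -
    have "a' * B / (1 - 2 * a' * B) \<le> a * B / (1 - 2 * a * (t + B))"
    proof -
      have "a' * (1 - 2 * a * (t + B)) \<le> a * (1 - 2 * a' * B)"
        using a'le by (simp add: algebra_simps)
      hence "B * (a' * (1 - 2 * a * (t + B))) \<le> B * (a * (1 - 2 * a' * B))" by (rule mult_left_mono[OF _ nn(1)])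
      thus ?thesis using lt a'B by (simp add: divide_simps mult_ac)
    qed
    moreover have "a * t \<le> a * t / (1 - 2 * a * (t + B))"
    proof -
      have "a * t * (1 - 2 * a * (t + B)) \<le> a * t"
        using at by (intro mult_left_le) (auto simp: algebra_simps)
      thus ?thesis using lt by (simp add: pos_le_divide_eq)
    qed
    ultimately show ?thesis by (simp add: add_divide_distrib algebra_simps)
  qed
  finally show ?case unfolding Bt by simp
qed (simp add: sum_sign_vectors_empty sign_vectors_def)

section \<open>Operator norms and the Euclidean bilinear form\<close>

text \<open>The tangent line of t^r at t = 1, obtained from Young's inequality for t^r and 1 with
  weights 1 / r and 1 - 1 / r.\<close>

lemma powr_ge_tangent:
  fixes t r :: real
  assumes "t \<ge> 0" "r \<ge> 1"
  shows "1 + r * (t - 1) \<le> t powr r"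
proof (cases "t = 0")
  case False
  hence t: "t > 0" using assms by simp
  have "(t powr r) powr (1 / r) * 1 powr (1 - 1 / r) \<le> (1 / r) * (t powr r) + (1 - 1 / r) * 1"
    using assms t by (intro Youngs_inequality_0) auto
  hence "t \<le> (1 / r) * (t powr r) + (1 - 1 / r)" using assms t by (simp add: powr_powr)
  hence "r * t \<le> r * ((1 / r) * (t powr r) + (1 - 1 / r))" using assms by (intro mult_left_mono) auto
  also have "\<dots> = t powr r + r - 1" using assms by (simp add: field_simps)
  finally show ?thesis by (simp add: algebra_simps)
qed (use assms in simp)

text \<open>The power mean inequality. With \<open>s\<close> the mean, the tangent bounds at t i / s
  are summed, and their linear terms add up to zero.\<close>

lemma sum_powr_le:
  fixes t :: "'i \<Rightarrow> real"
  assumes "finite I" "\<And>i. i \<in> I \<Longrightarrow> t i \<ge> 0" "r \<ge> 1"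
  shows "(\<Sum>i\<in>I. t i) powr r \<le> real (card I) powr (r - 1) * (\<Sum>i\<in>I. t i powr r)"
proof (cases "(\<Sum>i\<in>I. t i) = 0")
  case True
  thus ?thesis using assms by (auto intro!: mult_nonneg_nonneg sum_nonneg)
next
  case False
  define n s where "n = real (card I)" and "s = (\<Sum>i\<in>I. t i) / n"
  have ne: "I \<noteq> {}" using False by auto
  have n: "n > 0" using assms ne by (simp add: n_def card_gt_0_iff)
  have T: "(\<Sum>i\<in>I. t i) > 0" using False assms by (simp add: order_less_le sum_nonneg)
  have s: "s > 0" using T n by (simp add: s_def)
  have "n = (\<Sum>i\<in>I. 1 + r * (t i / s - 1))"
  proof -
    have "(\<Sum>i\<in>I. t i / s) = n" using n T unfolding sum_divide_distrib[symmetric] s_def by simp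
    thus ?thesis by (simp add: sum.distrib sum_subtractf sum_distrib_left[symmetric] n_def)
  qed
  also have "\<dots> \<le> (\<Sum>i\<in>I. (t i / s) powr r)"
    using assms s by (intro sum_mono powr_ge_tangent) auto
  also have "\<dots> = (\<Sum>i\<in>I. t i powr r) / s powr r"
    using assms s by (simp add: powr_divide sum_divide_distrib)
  finally have "n * s powr r \<le> (\<Sum>i\<in>I. t i powr r)" using s by (simp add: le_divide_eq)
  hence "n powr (r - 1) * (n * s powr r) \<le> n powr (r - 1) * (\<Sum>i\<in>I. t i powr r)"
    by (rule mult_left_mono) simp
  moreover have "n powr (r - 1) * (n * s powr r) = (\<Sum>i\<in>I. t i) powr r"
  proof -
    have "n powr (r - 1) * n = n powr r" using n by (simp add: powr_diff)
    thus ?thesis using n T by (simp add: s_def powr_divide mult.assoc[symmetric])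
  qed
  ultimately show ?thesis by (simp add: n_def)
qed

section \<open>Normalised norms\<close>

lemma lp_norm_finite: "lp_norm (ereal p) I x = (\<Sum>i\<in>I. \<bar>x i\<bar> powr p) powr (1 / p)"
  by (simp add: lp_norm_def)

lemma lp_norm_nonneg: "finite I \<Longrightarrow> I \<noteq> {} \<Longrightarrow> 0 \<le> lp_norm p I x"
  by (auto simp: lp_norm_def Max_ge_iff ex_in_conv)

lemma lp_norm_one_pos: "finite I \<Longrightarrow> I \<noteq> {} \<Longrightarrow> 0 < lp_norm p I (\<lambda>_. 1)"
  by (auto simp: lp_norm_def image_constant_conv card_gt_0_iff)

lemma lp_norm_sign: 
  assumes "u \<in> sign_vectors I"
  shows "lp_norm p I u = lp_norm p I (\<lambda>_. 1)"
proof -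
  have "\<And>i. i \<in> I \<Longrightarrow> \<bar>u i\<bar> = 1" using sign_vectors_abs[OF assms] .
  hence "(\<lambda>i. \<bar>u i\<bar>) ` I = (\<lambda>i. \<bar>1\<bar>) ` I" by (intro image_cong) auto
  moreover have "(\<Sum>i\<in>I. \<bar>u i\<bar> powr r) = (\<Sum>i\<in>I. \<bar>1\<bar> powr r)" for r
    using \<open>\<And>i. i \<in> I \<Longrightarrow> \<bar>u i\<bar> = 1\<close> by (intro sum.cong) auto
  ultimately show ?thesis unfolding lp_norm_def by simp
qed

lemma lp_norm_1: "lp_norm 1 I x = (\<Sum>i\<in>I. \<bar>x i\<bar>)"
  by (simp add: lp_norm_def one_ereal_def sum_nonneg)

lemma lp_norm_2: "lp_norm 2 I x = L2_set x I"
  by (simp add: lp_norm_def L2_set_def powr_half_sqrt sum_nonneg)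

text \<open>Dividing by the norm of the all-ones vector turns sums into averages, and power means
  increase with the exponent. For finite exponents \<open>sum_powr_le\<close> is applied to the
  numbers |x i|^a with r = b / a; for infinite q every entry is at most the maximum.\<close>

lemma normalized_lp_norm_mono:
  assumes "finite I" "I \<noteq> {}" "0 < p" "p \<le> q"
  shows "lp_norm p I x / lp_norm p I (\<lambda>_. 1) \<le> lp_norm q I x / lp_norm q I (\<lambda>_. 1)"
proof (cases p)
  case (real a)
  have a: "a > 0" using assms real by simp
  define n where "n = real (card I)"
  have n: "n > 0" using assms by (simp add: n_def card_gt_0_iff)
  show ?thesis
  proof (cases q)
    case q: (real b)
    have ab: "a \<le> b" "b > 0" using assms real q a by auto
    have "(\<Sum>i\<in>I. \<bar>x i\<bar> powr a) powr (b / a) \<le> n powr (b / a - 1) * (\<Sum>i\<in>I. (\<bar>x i\<bar> powr a) powr (b / a))"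
      unfolding n_def using a ab by (intro sum_powr_le assms) auto
    also have "(\<Sum>i\<in>I. (\<bar>x i\<bar> powr a) powr (b / a)) = (\<Sum>i\<in>I. \<bar>x i\<bar> powr b)"
      using a by (simp add: powr_powr)
    finally have "((\<Sum>i\<in>I. \<bar>x i\<bar> powr a) powr (b / a)) powr (1 / b) \<le> (n powr (b / a - 1) * (\<Sum>i\<in>I. \<bar>x i\<bar> powr b)) powr (1 / b)"
      using ab by (intro powr_mono2) auto
    hence "(\<Sum>i\<in>I. \<bar>x i\<bar> powr a) powr (1 / a) \<le> n powr (1 / a - 1 / b) * (\<Sum>i\<in>I. \<bar>x i\<bar> powr b) powr (1 / b)"
      using a ab n by (simp add: powr_powr powr_mult sum_nonneg diff_divide_distrib)
    hence "(\<Sum>i\<in>I. \<bar>x i\<bar> powr a) powr (1 / a) / n powr (1 / a) \<le> n powr (1 / a - 1 / b) * (\<Sum>i\<in>I. \<bar>x i\<bar> powr b) powr (1 / b) / n powr (1 / a)"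
      by (rule divide_right_mono) simp
    also have "\<dots> = (\<Sum>i\<in>I. \<bar>x i\<bar> powr b) powr (1 / b) / n powr (1 / b)"
      using n by (simp add: powr_diff)
    finally show ?thesis by (simp add: real q lp_norm_finite n_def)
  next
    case PInf
    define M where "M = Max ((\<lambda>i. \<bar>x i\<bar>) ` I)"
    have M: "\<bar>x i\<bar> \<le> M" if "i \<in> I" for i using assms that by (simp add: M_def)
    have M0: "M \<ge> 0" using M assms by (meson abs_ge_zero ex_in_conv order_trans)
    have "(\<Sum>i\<in>I. \<bar>x i\<bar> powr a) \<le> (\<Sum>i\<in>I. M powr a)"
      using M a by (intro sum_mono powr_mono2) auto
    hence "(\<Sum>i\<in>I. \<bar>x i\<bar> powr a) powr (1 / a) \<le> (n * M powr a) powr (1 / a)"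
      using a by (intro powr_mono2) (auto simp: n_def sum_nonneg)
    also have "\<dots> = n powr (1 / a) * M" using n a M0 by (simp add: powr_mult powr_powr)
    finally have "(\<Sum>i\<in>I. \<bar>x i\<bar> powr a) powr (1 / a) / n powr (1 / a) \<le> M"
      using n by (simp add: divide_le_eq mult.commute)
    moreover have "lp_norm q I x / lp_norm q I (\<lambda>_. 1) = M"
      using PInf assms by (simp add: lp_norm_def M_def image_constant_conv)
    ultimately show ?thesis using real by (simp add: lp_norm_finite n_def)
  qed (use assms in auto)
qed (use assms in auto)

section \<open>The bilinear form of a matrix and its relation to \<open>op_norm\<close>\<close>

definition bilin :: "'i set \<Rightarrow> ('i \<Rightarrow> real) \<Rightarrow> ('i \<times> 'i \<Rightarrow> real) \<Rightarrow> ('i \<Rightarrow> real) \<Rightarrow> real" where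
  "bilin I x A y = (\<Sum>i\<in>I. \<Sum>j\<in>I. x i * A (i, j) * y j)"

lemma bilin_eq_sum_Times: "bilin I x A y = (\<Sum>e\<in>I \<times> I. (x (fst e) * y (snd e)) * A e)"
  unfolding bilin_def by (simp add: sum.cartesian_product case_prod_unfold mult_ac)

lemma sum_Times_mult_square:
  "(\<Sum>e\<in>I \<times> J. (x (fst e) * y (snd e))\<^sup>2) = (\<Sum>i\<in>I. (x i)\<^sup>2) * (\<Sum>j\<in>J. (y j :: real)\<^sup>2)"
  by (simp add: sum_product sum.cartesian_product case_prod_unfold power_mult_distrib)

text \<open>Cauchy-Schwarz over the pairs (i, j). The bound is crude; it serves to make suprema
  finite and to settle zero vectors.\<close>

lemma bilin_le_frobenius: "bilin I x A y \<le> L2_set A (I \<times> I) * (L2_set x I * L2_set y I)"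
proof -
  have "bilin I x A y \<le> L2_set (\<lambda>e. x (fst e) * y (snd e)) (I \<times> I) * L2_set A (I \<times> I)"
  proof -
    have "bilin I x A y \<le> (\<Sum>e\<in>I \<times> I. \<bar>x (fst e) * y (snd e)\<bar> * \<bar>A e\<bar>)"
      unfolding bilin_eq_sum_Times by (intro sum_mono) (metis abs_ge_self abs_mult)
    also have "\<dots> \<le> L2_set (\<lambda>e. x (fst e) * y (snd e)) (I \<times> I) * L2_set A (I \<times> I)"
      by (rule L2_set_mult_ineq)
    finally show ?thesis .
  qed
  also have "L2_set (\<lambda>e. x (fst e) * y (snd e)) (I \<times> I) = L2_set x I * L2_set y I"
    unfolding L2_set_def by (simp add: sum_Times_mult_square real_sqrt_mult)
  finally show ?thesis by (simp add: mult_ac)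
qed

lemma bilin_mat_vec: "bilin {..<n} y A x = (\<Sum>i<n. y i * mat_vec n A x i)"
  unfolding bilin_def mat_vec_def by (simp add: sum_distrib_left mult.assoc)

text \<open>\<open>M\<close> bounds the Euclidean operator norm: testing the form with y = A x gives
  |A x|_2 <= M |x|_2. Since p <= 2 <= q, passing to normalised norms can only decrease the left side
  and increase the right one. The last factor is n^(1/p - 1/q).\<close>

lemma op_norm_ratio_le:
  assumes "n \<ge> 1" "q \<ge> 2" "1 \<le> p" "p \<le> 2" "M \<ge> 0"
    and M: "\<And>x y. bilin {..<n} y A x \<le> M * (L2_set y {..<n} * L2_set x {..<n})"
    and x: "\<exists>i<n. x i \<noteq> 0"
  shows "lp_norm p {..<n} (mat_vec n A x) / lp_norm q {..<n} x
    \<le> M * (lp_norm p {..<n} (\<lambda>_. 1) / lp_norm q {..<n} (\<lambda>_. 1))"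
proof -
  let ?I = "{..<n}"
  have I: "finite ?I" "?I \<noteq> {}" using assms by (auto simp: lessThan_empty_iff)
  have p0: "0 < p" using assms(3) by (simp add: less_le_trans[of 0 1])
  define a b where "a = lp_norm p ?I (\<lambda>_. 1)" and "b = lp_norm q ?I (\<lambda>_. 1)"
  have ab: "a > 0" "b > 0" unfolding a_def b_def by (intro lp_norm_one_pos I)+
  have c: "L2_set (\<lambda>_. 1) ?I = sqrt n" "sqrt n > 0" using assms(1) by (simp_all add: L2_set_def)
  define y where "y = mat_vec n A x"
  have L2x: "L2_set x ?I > 0"
    using x by (metis I(1) L2_set_eq_0_iff L2_set_nonneg lessThan_iff order_less_le)
  have yM: "L2_set y ?I \<le> M * L2_set x ?I"
  proof (cases "L2_set y ?I = 0")
    case False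
    hence pos: "L2_set y ?I > 0" by (simp add: order_less_le L2_set_nonneg)
    have "(L2_set y ?I)\<^sup>2 = (\<Sum>i<n. y i * y i)" by (simp add: L2_set_def sum_nonneg power2_eq_square)
    also have "\<dots> = bilin ?I y A x" by (simp add: bilin_mat_vec y_def)
    also have "\<dots> \<le> M * (L2_set y ?I * L2_set x ?I)" by (rule M)
    finally have "L2_set y ?I * L2_set y ?I \<le> L2_set y ?I * (M * L2_set x ?I)"
      by (simp add: power2_eq_square mult_ac)
    thus ?thesis using pos by simp
  qed (use L2x assms in auto)
  have "lp_norm p ?I y / a \<le> L2_set y ?I / sqrt n"
    using normalized_lp_norm_mono[OF I p0 assms(4), of y] unfolding lp_norm_2 c(1) a_def .
  also have "\<dots> \<le> M * L2_set x ?I / sqrt n" using yM by (intro divide_right_mono) auto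
  also have "\<dots> = M * (L2_set x ?I / sqrt n)" by simp
  also have "\<dots> \<le> M * (lp_norm q ?I x / b)"
    using normalized_lp_norm_mono[OF I _ assms(2), of x] unfolding lp_norm_2 c(1) b_def 
    by (intro mult_left_mono assms) auto
  finally have r: "lp_norm p ?I y / a \<le> M * (lp_norm q ?I x / b)" .
  have q: "lp_norm q ?I x > 0"
  proof -
    have "0 < L2_set x ?I / sqrt n" using L2x c by simp
    also have "\<dots> \<le> lp_norm q ?I x / b"
      using normalized_lp_norm_mono[OF I _ assms(2), of x] unfolding lp_norm_2 c(1) b_def by simp
    finally show ?thesis using ab by (simp add: zero_less_divide_iff)
  qed
  show ?thesis using r q ab unfolding y_def[symmetric] a_def[symmetric] b_def[symmetric]
    by (simp add: field_simps)
qed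

lemma op_norm_le:
  assumes "n \<ge> 1" "q \<ge> 2" "1 \<le> p" "p \<le> 2" "M \<ge> 0"
    and "\<And>x y. bilin {..<n} y A x \<le> M * (L2_set y {..<n} * L2_set x {..<n})"
  shows "op_norm q p n A \<le> M * (lp_norm p {..<n} (\<lambda>_. 1) / lp_norm q {..<n} (\<lambda>_. 1))"
  unfolding op_norm_def
proof (rule cSUP_least)
  have "(\<lambda>i\<in>{..<n}. 1) \<in> {x \<in> {..<n} \<rightarrow>\<^sub>E UNIV. \<exists>i<n. x i \<noteq> (0::real)}"
    using assms(1) by (auto intro!: exI[of _ 0])
  thus "{x \<in> {..<n} \<rightarrow>\<^sub>E UNIV. \<exists>i<n. x i \<noteq> (0::real)} \<noteq> {}" by blast
qed (use op_norm_ratio_le[OF assms] in auto)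

text \<open>As the entries of u are signs, u^T A v <= |A v|_1, and normalised norms increase from 1
  to p. The vector v then witnesses the supremum, its q-norm being that of the all-ones
  vector.\<close>

lemma op_norm_ge_bilin_sign:
  assumes "n \<ge> 1" "q \<ge> 2" "1 \<le> p" "p \<le> 2"
    and u: "u \<in> sign_vectors {..<n}" and v: "v \<in> sign_vectors {..<n}"
  shows "bilin {..<n} u A v / n * (lp_norm p {..<n} (\<lambda>_. 1) / lp_norm q {..<n} (\<lambda>_. 1)) \<le> op_norm q p n A"
proof -
  let ?I = "{..<n}" and ?y = "mat_vec n A v"
  have I: "finite ?I" "?I \<noteq> {}" using assms by (auto simp: lessThan_empty_iff)
  define a b where "a = lp_norm p ?I (\<lambda>_. 1)" and "b = lp_norm q ?I (\<lambda>_. 1)"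
  have ab: "a > 0" "b > 0" unfolding a_def b_def by (intro lp_norm_one_pos I)+
  have "bilin ?I u A v \<le> (\<Sum>i<n. \<bar>?y i\<bar>)"
    unfolding bilin_mat_vec
  proof (intro sum_mono)
    fix i assume "i \<in> ?I"
    thus "u i * ?y i \<le> \<bar>?y i\<bar>" using sign_vectors_cases[OF u] by fastforce
  qed
  hence "bilin ?I u A v / n \<le> lp_norm 1 ?I ?y / lp_norm 1 ?I (\<lambda>_. 1)"
    by (simp add: lp_norm_1 divide_right_mono)
  also have "\<dots> \<le> lp_norm p ?I ?y / a"
    unfolding a_def by (rule normalized_lp_norm_mono[OF I _ assms(3)]) simp
  finally have "bilin ?I u A v / n * (a / b) \<le> lp_norm p ?I ?y / a * (a / b)"
    using ab by (intro mult_right_mono) auto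
  also have "\<dots> = lp_norm p ?I ?y / lp_norm q ?I v"
    using ab by (simp add: lp_norm_sign[OF v] b_def)
  also have "\<dots> \<le> op_norm q p n A" unfolding op_norm_def
  proof (rule cSUP_upper)
    show "v \<in> {x \<in> ?I \<rightarrow>\<^sub>E UNIV. \<exists>i<n. x i \<noteq> 0}"
      using v sign_vectors_abs[OF v, of 0] assms(1) unfolding sign_vectors_def
      by (auto simp: PiE_def intro!: exI[of _ 0])
    \<comment> \<open>A real supremum is known to dominate its members only for a bounded set; the
      Frobenius norm provides a bound.\<close>
    show "bdd_above ((\<lambda>x. lp_norm p ?I (mat_vec n A x) / lp_norm q ?I x) ` {x \<in> ?I \<rightarrow>\<^sub>E UNIV. \<exists>i<n. x i \<noteq> 0})"
      using op_norm_ratio_le[OF assms(1-4) L2_set_nonneg bilin_le_frobenius] by (intro bdd_aboveI2) auto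
  qed
  finally show ?thesis unfolding a_def b_def .
qed

section \<open>Standard Gaussian vectors\<close>

definition std_normal :: "real measure" where
  "std_normal = density lborel std_normal_density"

definition gauss :: "'i set \<Rightarrow> ('i \<Rightarrow> real) measure" where
  "gauss I = (\<Pi>\<^sub>M i\<in>I. std_normal)"

text \<open>The likelihood ratio of the Gaussian vector with mean w and identity covariance against
  the standard one.\<close>

definition gauss_tilt :: "'i set \<Rightarrow> ('i \<Rightarrow> real) \<Rightarrow> ('i \<Rightarrow> real) \<Rightarrow> real" where
  "gauss_tilt I w A = exp ((\<Sum>i\<in>I. w i * A i) - (\<Sum>i\<in>I. (w i)\<^sup>2) / 2)"

lemma space_std_normal [simp]: "space std_normal = UNIV"
  by (simp add: std_normal_def)

lemma sets_std_normal [simp, measurable_cong]: "sets std_normal = sets borel"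
  by (simp add: std_normal_def)

lemma prob_space_std_normal: "prob_space std_normal"
  unfolding std_normal_def by (rule prob_space_normal_density) simp

lemma space_gauss: "space (gauss I) = I \<rightarrow>\<^sub>E UNIV"
  by (simp add: gauss_def space_PiM)

lemma sets_gauss [measurable_cong]: "sets (gauss I) = sets (\<Pi>\<^sub>M i\<in>I. borel)"
  unfolding gauss_def by (rule sets_PiM_cong) simp_all

lemma prob_space_gauss: "prob_space (gauss I)"
  unfolding gauss_def by (intro prob_space_PiM prob_space_std_normal)

text \<open>Lebesgue measure is translated by c; completing the square, the weight turns the normal
  density at c + y into the density at y.\<close>

lemma nn_integral_std_normal_shift:
  assumes [measurable]: "f \<in> borel_measurable borel"
  shows "(\<integral>\<^sup>+y. f (y + c) \<partial>std_normal) = (\<integral>\<^sup>+y. f y * ennreal (exp (c * y - c\<^sup>2 / 2)) \<partial>std_normal)"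
proof -
  have "(\<integral>\<^sup>+y. f y * ennreal (exp (c * y - c\<^sup>2 / 2)) \<partial>std_normal)
      = (\<integral>\<^sup>+y. ennreal (std_normal_density y) * (f y * ennreal (exp (c * y - c\<^sup>2 / 2))) \<partial>lborel)"
    unfolding std_normal_def by (subst nn_integral_density) auto
  also have "\<dots> = (\<integral>\<^sup>+y. ennreal (std_normal_density (c + y)) * (f (c + y) * ennreal (exp (c * (c + y) - c\<^sup>2 / 2))) \<partial>lborel)"
    by (subst nn_integral_real_affine[of _ 1 c]) auto
  also have "\<dots> = (\<integral>\<^sup>+y. ennreal (std_normal_density y) * f (y + c) \<partial>lborel)"
  proof (intro nn_integral_cong)
    fix y :: real
    have "std_normal_density (c + y) * exp (c * (c + y) - c\<^sup>2 / 2) = std_normal_density y"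
      unfolding std_normal_density_def
      by (simp add: exp_add[symmetric] power2_eq_square field_simps)
    hence "ennreal (std_normal_density (c + y)) * ennreal (exp (c * (c + y) - c\<^sup>2 / 2)) = ennreal (std_normal_density y)"
      by (simp add: ennreal_mult'[symmetric])
    thus "ennreal (std_normal_density (c + y)) * (f (c + y) * ennreal (exp (c * (c + y) - c\<^sup>2 / 2)))
        = ennreal (std_normal_density y) * f (y + c)"
      by (metis (no_types, opaque_lifting) add.commute mult.assoc mult.commute)
  qed
  also have "\<dots> = (\<integral>\<^sup>+y. f (y + c) \<partial>std_normal)"
    unfolding std_normal_def by (subst nn_integral_density) auto
  finally show ?thesis by simp
qed

lemma nn_integral_gauss_insert:
  assumes "finite I" "i \<notin> I" "f \<in> borel_measurable (gauss (insert i I))"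
  shows "(\<integral>\<^sup>+A. f A \<partial>gauss (insert i I)) = (\<integral>\<^sup>+x. (\<integral>\<^sup>+y. f (x(i := y)) \<partial>std_normal) \<partial>gauss I)"
proof -
  interpret product_sigma_finite "\<lambda>_. std_normal"
    by (intro product_sigma_finite.intro prob_space_imp_sigma_finite prob_space_std_normal)
  show ?thesis using assms unfolding gauss_def by (rule product_nn_integral_insert)
qed

section \<open>Shifts of Gaussian vectors (Cameron-Martin)\<close>

lemma measurable_gauss_add [measurable]:
  "(\<lambda>A. \<lambda>i\<in>I. A i + w i) \<in> measurable (gauss I) (gauss I)"
  unfolding gauss_def by measurable

lemma measurable_gauss_tilt [measurable]: "gauss_tilt I w \<in> borel_measurable (gauss I)"
  unfolding gauss_tilt_def by measurable

lemma gauss_tilt_pos: "gauss_tilt I w A > 0"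
  by (simp add: gauss_tilt_def)

text \<open>The tilt is a product over the coordinates: the one-dimensional shift treats the
  inserted coordinate and the induction hypothesis the others.\<close>

lemma nn_integral_gauss_shift:
  assumes "finite I" "f \<in> borel_measurable (gauss I)"
  shows "(\<integral>\<^sup>+A. f (\<lambda>i\<in>I. A i + w i) \<partial>gauss I) = (\<integral>\<^sup>+A. f A * ennreal (gauss_tilt I w A) \<partial>gauss I)"
  using assms
proof (induction I arbitrary: f rule: finite_induct)
  case empty
  have "(\<lambda>i\<in>{}. A i + w i) = A" if "A \<in> space (gauss {})" for A
    using that by (auto simp: space_gauss)
  thus ?case by (intro nn_integral_cong) (simp add: gauss_tilt_def)
next
  case (insert i I)
  note [measurable] = insert.prems
  have upd [measurable]: "(\<lambda>(x, y). x(i := y)) \<in> measurable (gauss I \<Otimes>\<^sub>M std_normal) (gauss (insert i I))"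
    unfolding gauss_def by measurable
  interpret N: prob_space std_normal by (rule prob_space_std_normal)
  \<comment> \<open>The inner integral after the inserted coordinate has been shifted, as a function
    of the coordinates in \<open>I\<close>, which remain to be treated.\<close>
  define F where "F x = (\<integral>\<^sup>+y. f (x(i := y)) * ennreal (exp (w i * y - (w i)\<^sup>2 / 2)) \<partial>std_normal)" for x
  have F [measurable]: "F \<in> borel_measurable (gauss I)" unfolding F_def by measurable
  have "(\<integral>\<^sup>+A. f (\<lambda>k\<in>insert i I. A k + w k) \<partial>gauss (insert i I))
      = (\<integral>\<^sup>+x. (\<integral>\<^sup>+y. f (\<lambda>k\<in>insert i I. (x(i := y)) k + w k) \<partial>std_normal) \<partial>gauss I)"
    using insert.hyps by (subst nn_integral_gauss_insert) (auto simp: measurable_compose[OF measurable_gauss_add])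
  also have "\<dots> = (\<integral>\<^sup>+x. F (\<lambda>k\<in>I. x k + w k) \<partial>gauss I)"
  proof (intro nn_integral_cong)
    fix x assume x: "x \<in> space (gauss I)"
    have x': "(\<lambda>k\<in>I. x k + w k) \<in> space (gauss I)" by (simp add: space_gauss)
    have eq: "(\<lambda>k\<in>insert i I. (x(i := y)) k + w k) = (\<lambda>k\<in>I. x k + w k)(i := y + w i)" for y
      using insert.hyps by (auto simp: fun_eq_iff)
    have "(\<lambda>y. f ((\<lambda>k\<in>I. x k + w k)(i := y))) \<in> borel_measurable std_normal"
      using measurable_compose[OF measurable_Pair1'[OF x'] measurable_compose[OF upd insert.prems]] by (simp del: fun_upd_apply)
    hence "(\<lambda>y. f ((\<lambda>k\<in>I. x k + w k)(i := y))) \<in> borel_measurable borel"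
      by (simp cong: measurable_cong_sets)
    from nn_integral_std_normal_shift[OF this, of "w i"]
    show "(\<integral>\<^sup>+y. f (\<lambda>k\<in>insert i I. (x(i := y)) k + w k) \<partial>std_normal) = F (\<lambda>k\<in>I. x k + w k)"
      unfolding eq F_def .
  qed
  also have "\<dots> = (\<integral>\<^sup>+x. F x * ennreal (gauss_tilt I w x) \<partial>gauss I)"
    by (rule insert.IH) (rule F)
  also have "\<dots> = (\<integral>\<^sup>+x. (\<integral>\<^sup>+y. f (x(i := y)) * ennreal (gauss_tilt (insert i I) w (x(i := y))) \<partial>std_normal) \<partial>gauss I)"
  proof (intro nn_integral_cong)
    fix x assume x: "x \<in> space (gauss I)"
    have m: "(\<lambda>y. f (x(i := y))) \<in> borel_measurable std_normal"
      using measurable_compose[OF measurable_Pair1'[OF x] measurable_compose[OF upd insert.prems]] by (simp del: fun_upd_apply)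
    have t: "gauss_tilt (insert i I) w (x(i := y)) = exp (w i * y - (w i)\<^sup>2 / 2) * gauss_tilt I w x" for y
    proof -
      have "(\<Sum>k\<in>I. w k * (x(i := y)) k) = (\<Sum>k\<in>I. w k * x k)"
        using insert.hyps by (intro sum.cong) auto
      thus ?thesis unfolding gauss_tilt_def using insert.hyps
        by (simp add: exp_add[symmetric] add_divide_distrib)
    qed
    show "F x * ennreal (gauss_tilt I w x) = (\<integral>\<^sup>+y. f (x(i := y)) * ennreal (gauss_tilt (insert i I) w (x(i := y))) \<partial>std_normal)"
      unfolding F_def t using m
      by (subst nn_integral_multc[symmetric]) (auto simp: ennreal_mult'' mult_ac)
  qed
  also have "\<dots> = (\<integral>\<^sup>+A. f A * ennreal (gauss_tilt (insert i I) w A) \<partial>gauss (insert i I))"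
    using insert.hyps by (subst nn_integral_gauss_insert) auto
  finally show ?case .
qed

lemma has_bochner_integral_gauss_shift:
  assumes "finite I" "h \<in> borel_measurable (gauss I)" "\<And>A. 0 \<le> h A" "\<And>A. h A \<le> 1"
  shows "has_bochner_integral (gauss I) (\<lambda>A. h A * gauss_tilt I w A)
           (\<integral>A. h (\<lambda>i\<in>I. A i + w i) \<partial>gauss I)"
proof -
  note [measurable] = assms(2)
  interpret prob_space "gauss I" by (rule prob_space_gauss)
  have m: "(\<lambda>A. h (\<lambda>i\<in>I. A i + w i)) \<in> borel_measurable (gauss I)"
    by (rule measurable_compose[OF measurable_gauss_add assms(2)])
  have i: "integrable (gauss I) (\<lambda>A. h (\<lambda>i\<in>I. A i + w i))"
    using assms(3,4) by (intro integrable_const_bound[of _ 1] m) auto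
  have "(\<integral>\<^sup>+A. ennreal (h A * gauss_tilt I w A) \<partial>gauss I) = (\<integral>\<^sup>+A. ennreal (h (\<lambda>i\<in>I. A i + w i)) \<partial>gauss I)"
    using assms(1,3) gauss_tilt_pos
    by (subst nn_integral_gauss_shift[of I "\<lambda>A. ennreal (h A)"]) (auto simp: ennreal_mult' less_imp_le)
  also have "\<dots> = ennreal (\<integral>A. h (\<lambda>i\<in>I. A i + w i) \<partial>gauss I)"
    using assms(3) by (intro nn_integral_eq_integral i) auto
  finally show ?thesis
    using assms(3) less_imp_le[OF gauss_tilt_pos]
    by (intro has_bochner_integral_nn_integral) (auto intro!: AE_I2 mult_nonneg_nonneg integral_nonneg)
qed

lemma has_bochner_integral_gauss_tilt:
  assumes "finite I"
  shows "has_bochner_integral (gauss I) (gauss_tilt I w) 1"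
proof -
  interpret prob_space "gauss I" by (rule prob_space_gauss)
  show ?thesis using has_bochner_integral_gauss_shift[OF assms, of "\<lambda>_. 1" w] by (simp add: prob_space)
qed

lemma gauss_tilt_mult:
  "gauss_tilt I w A * gauss_tilt I w' A = exp (\<Sum>i\<in>I. w i * w' i) * gauss_tilt I (\<lambda>i. w i + w' i) A"
  unfolding gauss_tilt_def
  by (simp add: exp_add[symmetric] sum.distrib power2_sum algebra_simps sum_distrib_left add_divide_distrib)

text \<open>This is the correlation of two likelihood ratios: by expanding |w + w'|^2, their product
  is a tilt of mean one times the exponential of the inner product.\<close>

lemma has_bochner_integral_gauss_tilt_mult:
  assumes "finite I"
  shows "has_bochner_integral (gauss I) (\<lambda>A. gauss_tilt I w A * gauss_tilt I w' A) (exp (\<Sum>i\<in>I. w i * w' i))"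
  unfolding gauss_tilt_mult
  using has_bochner_integral_mult_right[OF has_bochner_integral_gauss_tilt[OF assms], of "exp (\<Sum>i\<in>I. w i * w' i)"]
  by simp

text \<open>The second-moment method: the likelihood ratio \<open>\<Lambda>\<close> of the truncated mixture is close
  to \<open>1\<close> in \<open>L\<^sup>2\<close>, and \<open>\<bar>1 - \<Lambda>\<bar> \<le> 1 / 4 + (1 - \<Lambda>)\<^sup>2\<close>.\<close>

lemma gauss_mixture_indistinguishable:
  fixes w :: "'u \<Rightarrow> 'i \<Rightarrow> real"
  assumes "finite I" "finite U" "E \<subseteq> U" "U \<noteq> {}"
    and E: "9 * card U \<le> 10 * card E"
    and sm: "(\<Sum>u\<in>E. \<Sum>v\<in>E. exp (\<Sum>i\<in>I. w u i * w v i)) \<le> 21 / 20 * (real (card U))\<^sup>2"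
    and h: "h \<in> borel_measurable (gauss I)" "\<And>A. 0 \<le> h A" "\<And>A. h A \<le> 1"
  shows "(\<integral>A. h A \<partial>gauss I) \<le> 1 / 2 + (\<Sum>u\<in>U. \<integral>A. h (\<lambda>i\<in>I. A i + w u i) \<partial>gauss I) / card U"
proof -
  note [measurable] = h(1)
  interpret prob_space "gauss I" by (rule prob_space_gauss)
  define N where "N = real (card U)"
  have N: "N > 0" using assms by (simp add: N_def card_gt_0_iff)
  \<comment> \<open>Division by the size of U, not of E, drops the shifts outside E and leaves a
    mixture of total mass at least 9/10.\<close>
  define \<Lambda> where "\<Lambda> A = (\<Sum>u\<in>E. gauss_tilt I (w u) A) / N" for A
  have hint: "has_bochner_integral (gauss I) (\<lambda>A. h A * \<Lambda> A) ((\<Sum>u\<in>E. \<integral>A. h (\<lambda>i\<in>I. A i + w u i) \<partial>gauss I) / N)"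
    unfolding \<Lambda>_def times_divide_eq_right sum_distrib_left
    by (intro has_bochner_integral_divide_zero has_bochner_integral_sum has_bochner_integral_gauss_shift assms)
  have L1: "has_bochner_integral (gauss I) \<Lambda> (card E / N)"
    unfolding \<Lambda>_def
    using has_bochner_integral_divide_zero[OF has_bochner_integral_sum[of E "gauss I" "\<lambda>u. gauss_tilt I (w u)" "\<lambda>_. 1"], of N]
      has_bochner_integral_gauss_tilt[OF assms(1)] by simp
  have L2: "has_bochner_integral (gauss I) (\<lambda>A. (\<Lambda> A)\<^sup>2) ((\<Sum>u\<in>E. \<Sum>v\<in>E. exp (\<Sum>i\<in>I. w u i * w v i)) / N\<^sup>2)"
    unfolding \<Lambda>_def power_divide unfolding power2_eq_square[of "sum _ _"] sum_product
    by (intro has_bochner_integral_divide_zero has_bochner_integral_sum has_bochner_integral_gauss_tilt_mult assms)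
  have hi: "integrable (gauss I) h" using h by (intro integrable_const_bound[of _ 1]) auto
  have sq: "has_bochner_integral (gauss I) (\<lambda>A. 1 / 4 + ((\<Lambda> A)\<^sup>2 - 2 * \<Lambda> A + 1))
    (1 / 4 + ((\<Sum>u\<in>E. \<Sum>v\<in>E. exp (\<Sum>i\<in>I. w u i * w v i)) / N\<^sup>2 - 2 * (card E / N) + 1))"
    by (intro has_bochner_integral_add has_bochner_integral_diff has_bochner_integral_mult_right L1 L2)
       (simp_all add: has_bochner_integral_iff prob_space)
  have "(\<integral>A. h A \<partial>gauss I) - (\<integral>A. h A * \<Lambda> A \<partial>gauss I) = (\<integral>A. h A - h A * \<Lambda> A \<partial>gauss I)"
    using hi hint by (simp add: has_bochner_integral_iff)
  also have "\<dots> \<le> (\<integral>A. 1 / 4 + ((\<Lambda> A)\<^sup>2 - 2 * \<Lambda> A + 1) \<partial>gauss I)"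
  proof (intro integral_mono)
    fix A
    have "h A - h A * \<Lambda> A \<le> \<bar>h A * (1 - \<Lambda> A)\<bar>" by (simp add: algebra_simps)
    also have "\<dots> \<le> 1 * \<bar>1 - \<Lambda> A\<bar>" unfolding abs_mult using h by (intro mult_right_mono) auto
    also have "\<dots> \<le> 1 / 4 + (1 - \<Lambda> A)\<^sup>2"
      using zero_le_power2[of "\<bar>1 - \<Lambda> A\<bar> - 1 / 2"] unfolding power2_diff power2_abs by (simp add: power2_eq_square)
    finally show "h A - h A * \<Lambda> A \<le> 1 / 4 + ((\<Lambda> A)\<^sup>2 - 2 * \<Lambda> A + 1)" by (simp add: power2_diff)
  qed (use hi hint sq in \<open>auto simp: has_bochner_integral_iff\<close>)
  also have "\<dots> = 1 / 4 + ((\<Sum>u\<in>E. \<Sum>v\<in>E. exp (\<Sum>i\<in>I. w u i * w v i)) / N\<^sup>2 - 2 * (card E / N) + 1)"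
    using sq by (simp add: has_bochner_integral_iff)
  \<comment> \<open>The second moment is at most 21/20 and the mass at least 9/10, so the squared
    distance of the ratio from 1 contributes at most 1/4.\<close>
  also have "\<dots> \<le> 1 / 4 + (21 / 20 - 2 * (9 / 10) + 1)"
  proof -
    have "(\<Sum>u\<in>E. \<Sum>v\<in>E. exp (\<Sum>i\<in>I. w u i * w v i)) / N\<^sup>2 \<le> 21 / 20"
      using sm N by (simp add: N_def divide_le_eq)
    moreover have "9 / 10 \<le> card E / N"
      using E N unfolding N_def by (simp add: le_divide_eq)
    ultimately show ?thesis by linarith
  qed
  also have "\<dots> = 1 / 2" by simp
  finally have "(\<integral>A. h A \<partial>gauss I) \<le> 1 / 2 + (\<Sum>u\<in>E. \<integral>A. h (\<lambda>i\<in>I. A i + w u i) \<partial>gauss I) / N"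
    using hint by (simp add: has_bochner_integral_iff)
  \<comment> \<open>The dropped shifts return at no cost, since h is nonnegative.\<close>
  also have "\<dots> \<le> 1 / 2 + (\<Sum>u\<in>U. \<integral>A. h (\<lambda>i\<in>I. A i + w u i) \<partial>gauss I) / N"
    using N assms by (intro add_left_mono divide_right_mono sum_mono2) (auto intro: integral_nonneg)
  finally show ?thesis by (simp add: N_def)
qed

section \<open>The operator norm of a Gaussian matrix\<close>

text \<open>Chernoff's bound: Markov's inequality for the tilt by c, which has mean one and exceeds
  exp (s - |c|^2 / 2) on the event. The usual scale parameter is absorbed in c.\<close>

lemma gauss_linear_tail:
  assumes "finite I"
  shows "measure (gauss I) {A \<in> space (gauss I). (\<Sum>i\<in>I. c i * A i) > s} \<le> exp ((\<Sum>i\<in>I. (c i)\<^sup>2) / 2 - s)"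
proof -
  interpret prob_space "gauss I" by (rule prob_space_gauss)
  let ?S = "(\<Sum>i\<in>I. (c i)\<^sup>2) / 2"
  have t: "has_bochner_integral (gauss I) (gauss_tilt I c) 1" by (rule has_bochner_integral_gauss_tilt) fact
  have "{A \<in> space (gauss I). (\<Sum>i\<in>I. c i * A i) > s} \<subseteq> {A \<in> space (gauss I). gauss_tilt I c A \<ge> exp (s - ?S)}"
    by (auto simp: gauss_tilt_def)
  moreover have "{A \<in> space (gauss I). gauss_tilt I c A \<ge> exp (s - ?S)} \<in> sets (gauss I)" by measurable
  ultimately have "measure (gauss I) {A \<in> space (gauss I). (\<Sum>i\<in>I. c i * A i) > s}
      \<le> measure (gauss I) {A \<in> space (gauss I). gauss_tilt I c A \<ge> exp (s - ?S)}"
    by (rule finite_measure_mono)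
  also have "\<dots> \<le> (\<integral>A. gauss_tilt I c A \<partial>gauss I) / exp (s - ?S)"
    using t less_imp_le[OF gauss_tilt_pos] by (intro integral_Markov_inequality_measure) (auto simp: has_bochner_integral_iff)
  also have "\<dots> = exp (?S - s)" using t by (simp add: has_bochner_integral_iff exp_diff)
  finally show ?thesis .
qed

section \<open>An integer net for the Euclidean unit ball\<close>

lemma abs_le_square_int: "\<bar>k\<bar> \<le> k\<^sup>2" for k :: int
proof (cases "k = 0")
  case False
  hence "\<bar>k\<bar> * 1 \<le> \<bar>k\<bar> * \<bar>k\<bar>" by (intro mult_left_mono) auto
  thus ?thesis by (simp add: power2_eq_square)
qed simp

text \<open>Divided by 4 sqrt n, where n = \<open>card I\<close>, these integer vectors approximate
  every point of the Euclidean unit ball to within 1/4. The box has radius 16 n because |z i| <= (z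
  i)^2 for integers.\<close>

definition lattice_net :: "'i set \<Rightarrow> ('i \<Rightarrow> int) set" where
  "lattice_net I = {z \<in> I \<rightarrow>\<^sub>E {- 16 * int (card I)..16 * int (card I)}. (\<Sum>i\<in>I. (z i)\<^sup>2) \<le> 16 * int (card I)}"

lemma finite_lattice_net: "finite I \<Longrightarrow> finite (lattice_net I)"
  unfolding lattice_net_def 
  by (rule finite_subset[OF _ finite_PiE[of I "\<lambda>_. {- 16 * int (card I)..16 * int (card I)}"]]) auto

lemma sum_half_power_abs: "(\<Sum>k\<in>{- int m..int m}. (1 / 2 :: real) ^ nat \<bar>k\<bar>) = 3 - 2 * (1 / 2) ^ m"
proof (induction m)
  case (Suc m)
  have "{- int (Suc m)..int (Suc m)} = insert (- int (Suc m)) (insert (int (Suc m)) {- int m..int m})" by auto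
  thus ?case using Suc by (simp add: nat_add_distrib)
qed simp

text \<open>On the net the sum of the |z i| is at most 16 n, so 2^(16 n) times the product of the
  2^(- |z i|) is at least 1. Summed over the whole box this weight factorises into n geometric sums,
  each at most 4.\<close>

lemma card_lattice_net:
  assumes "finite I"
  shows "real (card (lattice_net I)) \<le> 2 ^ (18 * card I)"
proof -
  let ?n = "card I"
  let ?B = "{- 16 * int ?n..16 * int ?n}"
  have "1 \<le> 2 ^ (16 * ?n) * (\<Prod>i\<in>I. (1 / 2 :: real) ^ nat \<bar>z i\<bar>)" if z: "z \<in> lattice_net I" for z
  proof -
    have "int (\<Sum>i\<in>I. nat \<bar>z i\<bar>) = (\<Sum>i\<in>I. \<bar>z i\<bar>)" by simp
    also have "\<dots> \<le> (\<Sum>i\<in>I. (z i)\<^sup>2)"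
    proof (intro sum_mono)
      fix i
      show "\<bar>z i\<bar> \<le> (z i)\<^sup>2"
        by (rule abs_le_square_int)
    qed
    also have "\<dots> \<le> 16 * int ?n" using z by (simp add: lattice_net_def)
    finally have "(\<Sum>i\<in>I. nat \<bar>z i\<bar>) \<le> 16 * ?n" by linarith
    hence "(1 / 2 :: real) ^ (16 * ?n) \<le> (1 / 2) ^ (\<Sum>i\<in>I. nat \<bar>z i\<bar>)" by (intro power_decreasing) auto
    hence "2 ^ (16 * ?n) * (1 / 2 :: real) ^ (16 * ?n) \<le> 2 ^ (16 * ?n) * (1 / 2) ^ (\<Sum>i\<in>I. nat \<bar>z i\<bar>)"
      by (rule mult_left_mono) simp
    thus ?thesis by (simp add: power_sum power_mult_distrib[symmetric])
  qed
  hence "real (card (lattice_net I)) \<le> (\<Sum>z\<in>lattice_net I. 2 ^ (16 * ?n) * (\<Prod>i\<in>I. (1 / 2 :: real) ^ nat \<bar>z i\<bar>))"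
    by (subst real_of_card) (rule sum_mono)
  also have "\<dots> \<le> (\<Sum>z\<in>I \<rightarrow>\<^sub>E ?B. 2 ^ (16 * ?n) * (\<Prod>i\<in>I. (1 / 2 :: real) ^ nat \<bar>z i\<bar>))"
    using assms by (intro sum_mono2 finite_PiE) (auto simp: lattice_net_def intro!: mult_nonneg_nonneg prod_nonneg)
  also have "\<dots> = 2 ^ (16 * ?n) * (\<Prod>i\<in>I. \<Sum>k\<in>?B. (1 / 2 :: real) ^ nat \<bar>k\<bar>)"
    using assms by (subst prod_sum_PiE) (auto simp: sum_distrib_left)
  also have "\<dots> \<le> 2 ^ (16 * ?n) * (\<Prod>i\<in>I. 4)"
  proof (intro mult_left_mono prod_mono conjI)
    have "(\<Sum>k\<in>?B. (1 / 2 :: real) ^ nat \<bar>k\<bar>) = 3 - 2 * (1 / 2) ^ (16 * ?n)"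
      using sum_half_power_abs[of "16 * ?n"] by simp
    thus "(\<Sum>k\<in>?B. (1 / 2 :: real) ^ nat \<bar>k\<bar>) \<le> 4" by (smt (verit) zero_le_power zero_le_divide_1_iff)
  qed (auto intro: sum_nonneg)
  also have "\<dots> = 2 ^ (18 * ?n)"
  proof -
    have "(4::real) ^ ?n = 2 ^ (2 * ?n)" by (simp add: power_mult)
    thus ?thesis by (simp add: power_add[symmetric])
  qed
  finally show ?thesis .
qed

text \<open>Rounding toward zero, rather than down, never increases absolute values, so a rounded
  vector stays in its ball.\<close>

definition toward_zero :: "real \<Rightarrow> int" where
  "toward_zero t = (if t \<ge> 0 then \<lfloor>t\<rfloor> else - \<lfloor>- t\<rfloor>)"

lemma toward_zero: "\<bar>real_of_int (toward_zero t)\<bar> \<le> \<bar>t\<bar>" "\<bar>t - real_of_int (toward_zero t)\<bar> \<le> 1"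
  unfolding toward_zero_def by (auto; linarith)+

text \<open>Each coordinate of 4 sqrt n x is rounded toward zero. Errors of at most 1 become 1 / (4
  sqrt n) after rescaling, hence at most 1/4 in Euclidean norm.\<close>

lemma lattice_net_approx:
  fixes x :: "'i \<Rightarrow> real"
  assumes "finite I" "I \<noteq> {}" "L2_set x I \<le> 1"
  obtains z where "z \<in> lattice_net I"
    "L2_set (\<lambda>i. x i - of_int (z i) / (4 * sqrt (card I))) I \<le> 1 / 4"
proof -
  define s where "s = 4 * sqrt (card I)"
  have n: "card I \<ge> 1" using assms by (simp add: Suc_le_eq card_gt_0_iff)
  have s: "s > 0" "s\<^sup>2 = 16 * real (card I)" using n by (auto simp: s_def power_mult_distrib)
  define z where "z = (\<lambda>i\<in>I. toward_zero (s * x i))"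
  have "L2_set (\<lambda>i. x i - of_int (z i) / s) I \<le> 1 / 4"
  proof -
    have le: "(x i - of_int (z i) / s)\<^sup>2 \<le> 1 / s\<^sup>2" if "i \<in> I" for i
    proof -
      have "\<bar>s * x i - of_int (z i)\<bar> \<le> 1" using toward_zero[of "s * x i"] that by (simp add: z_def)
      hence "(s * x i - of_int (z i))\<^sup>2 \<le> 1" by (simp add: abs_square_le_1)
      moreover have "x i - of_int (z i) / s = (s * x i - of_int (z i)) / s" using s by (simp add: field_simps)
      ultimately show ?thesis using s by (simp add: power_divide divide_right_mono)
    qed
    have "(\<Sum>i\<in>I. (x i - of_int (z i) / s)\<^sup>2) \<le> (\<Sum>i\<in>I. 1 / s\<^sup>2)" by (rule sum_mono[OF le])
    also have "\<dots> = (1 / 4)\<^sup>2" using n unfolding s(2) by (simp add: power2_eq_square)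
    finally show ?thesis unfolding L2_set_def by (intro real_le_lsqrt) auto
  qed
  moreover have "z \<in> lattice_net I"
  proof -
    have zs: "(real_of_int (z i))\<^sup>2 \<le> (s * x i)\<^sup>2" if "i \<in> I" for i
      using toward_zero(1)[of "s * x i"] that by (simp add: z_def abs_le_square_iff)
    have "(\<Sum>i\<in>I. (x i)\<^sup>2) \<le> 1" using assms(3) by (simp add: L2_set_def)
    hence "(\<Sum>i\<in>I. (s * x i)\<^sup>2) \<le> 16 * card I"
      by (simp add: power_mult_distrib sum_distrib_left[symmetric] s mult_left_le)
    moreover have "real_of_int (\<Sum>i\<in>I. (z i)\<^sup>2) \<le> (\<Sum>i\<in>I. (s * x i)\<^sup>2)"
      using zs by (simp add: sum_mono)
    ultimately have S: "(\<Sum>i\<in>I. (z i)\<^sup>2) \<le> 16 * int (card I)" by linarith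
    have "z i \<in> {- 16 * int (card I)..16 * int (card I)}" if "i \<in> I" for i
    proof -
      have "\<bar>z i\<bar> \<le> (z i)\<^sup>2"
        by (rule abs_le_square_int)
      also have "\<dots> \<le> (\<Sum>i\<in>I. (z i)\<^sup>2)" using assms that by (intro member_le_sum) auto
      finally show ?thesis using S by auto
    qed
    thus ?thesis using S unfolding lattice_net_def by (auto simp: PiE_def z_def)
  qed
  ultimately show ?thesis using that unfolding s_def by blast
qed

section \<open>From the net to all vectors\<close>

lemma bilin_scale: "bilin I (\<lambda>i. a * x i) A (\<lambda>i. b * y i) = a * b * bilin I x A y"
  unfolding bilin_def sum_distrib_left by (simp add: mult_ac)

lemma bilin_diff_left: "bilin I (\<lambda>i. x i - x' i) A y = bilin I x A y - bilin I x' A y"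
  unfolding bilin_def by (simp add: sum_subtractf[symmetric] algebra_simps)

lemma bilin_diff_right: "bilin I x A (\<lambda>i. y i - y' i) = bilin I x A y - bilin I x A y'"
  unfolding bilin_def by (simp add: sum_subtractf[symmetric] algebra_simps)

lemma L2_set_scale: "L2_set (\<lambda>i. a * x i) I = \<bar>a\<bar> * L2_set x I"
  unfolding L2_set_def by (simp add: power_mult_distrib sum_distrib_left[symmetric] real_sqrt_mult)

lemma bilin_le_of_unit:
  assumes "finite I" "\<And>x y. L2_set x I \<le> 1 \<Longrightarrow> L2_set y I \<le> 1 \<Longrightarrow> bilin I x A y \<le> M"
  shows "bilin I x A y \<le> M * (L2_set x I * L2_set y I)"
proof (cases "L2_set x I = 0 \<or> L2_set y I = 0")
  case True
  have "bilin I x A y \<le> L2_set A (I \<times> I) * (L2_set x I * L2_set y I)" by (rule bilin_le_frobenius)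
  thus ?thesis using True by auto
next
  case False
  define a b where "a = L2_set x I" and "b = L2_set y I"
  have ab: "a > 0" "b > 0" using False by (simp_all add: a_def b_def order_less_le L2_set_nonneg)
  have "bilin I (\<lambda>i. (1 / a) * x i) A (\<lambda>i. (1 / b) * y i) \<le> M"
    using ab by (intro assms(2)) (simp_all only: L2_set_scale, simp_all add: a_def b_def)
  hence "bilin I x A y / (a * b) \<le> M" unfolding bilin_scale using ab by simp
  thus ?thesis using ab by (simp add: divide_le_eq a_def b_def)
qed

text \<open>Let M be the supremum of the form over the unit ball. Replacing x and y by net points
  costs at most M / 4 each, and at rescaled net points the form is at most 160 n sqrt n / (16 n) =
  10 sqrt n. So M <= 10 sqrt n + M / 2, which can be solved because M is finite.\<close>

lemma bilin_le_of_lattice_net: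
  fixes A :: "'i \<times> 'i \<Rightarrow> real"
  assumes "finite I" "I \<noteq> {}"
    and net: "\<And>z w. z \<in> lattice_net I \<Longrightarrow> w \<in> lattice_net I \<Longrightarrow>
      bilin I (\<lambda>i. of_int (z i)) A (\<lambda>i. of_int (w i)) \<le> 160 * real (card I) * sqrt (card I)"
  shows "bilin I x A y \<le> 20 * sqrt (card I) * (L2_set x I * L2_set y I)"
proof -
  define n where "n = real (card I)"
  have n: "n > 0" using assms by (simp add: n_def card_gt_0_iff)
  define P where "P = {x. L2_set x I \<le> 1}"
  define F where "F = (\<lambda>(x, y). bilin I x A y)"
  define M where "M = Sup (F ` (P \<times> P))"
  have P0: "(\<lambda>_. 0) \<in> P" by (simp add: P_def L2_set_def)
  have bdd: "bdd_above (F ` (P \<times> P))"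
  proof (rule bdd_aboveI2)
    fix xy assume "xy \<in> P \<times> P"
    then obtain x y where xy: "xy = (x, y)" "L2_set x I \<le> 1" "L2_set y I \<le> 1" by (auto simp: P_def)
    have "bilin I x A y \<le> L2_set A (I \<times> I) * (L2_set x I * L2_set y I)" by (rule bilin_le_frobenius)
    also have "\<dots> \<le> L2_set A (I \<times> I) * (1 * 1)"
      using xy by (intro mult_left_mono mult_mono) (auto simp: L2_set_nonneg)
    finally show "F xy \<le> L2_set A (I \<times> I)" by (simp add: F_def xy)
  qed
  have unit: "bilin I x A y \<le> M" if "L2_set x I \<le> 1" "L2_set y I \<le> 1" for x y
    using cSUP_upper[OF _ bdd, of "(x, y)"] that by (simp add: M_def P_def F_def)
  have all: "bilin I x A y \<le> M * (L2_set x I * L2_set y I)" for x y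
    by (rule bilin_le_of_unit[OF assms(1) unit])
  have M0: "M \<ge> 0" using unit[of "\<lambda>_. 0" "\<lambda>_. 0"] by (simp add: bilin_def L2_set_def)
  have "M \<le> 10 * sqrt n + M / 2"
    unfolding M_def
  proof (rule cSUP_least, goal_cases)
    case (2 xy)
    then obtain x y where xy: "xy = (x, y)" "L2_set x I \<le> 1" "L2_set y I \<le> 1" by (auto simp: P_def)
    define s where "s = 4 * sqrt (card I)"
    have s: "s > 0" "s * s = 16 * n" using n by (auto simp: s_def n_def)
    obtain z where z: "z \<in> lattice_net I" "L2_set (\<lambda>i. x i - of_int (z i) / s) I \<le> 1 / 4"
      unfolding s_def by (rule lattice_net_approx[OF assms(1,2) xy(2)])
    obtain w where w: "w \<in> lattice_net I" "L2_set (\<lambda>i. y i - of_int (w i) / s) I \<le> 1 / 4"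
      unfolding s_def by (rule lattice_net_approx[OF assms(1,2) xy(3)])
    define x' y' where "x' = (\<lambda>i. of_int (z i) / s)" and "y' = (\<lambda>i. of_int (w i) / s)"
    have x'1: "L2_set x' I \<le> 1"
    proof -
      have "(\<Sum>i\<in>I. (z i)\<^sup>2) \<le> 16 * int (card I)" using z by (simp add: lattice_net_def)
      hence "real_of_int (\<Sum>i\<in>I. (z i)\<^sup>2) \<le> 16 * n" unfolding n_def by linarith
      hence "(\<Sum>i\<in>I. (x' i)\<^sup>2) \<le> 1" using n
        unfolding x'_def power_divide sum_divide_distrib[symmetric] power2_eq_square[of s] s(2) by simp
      thus ?thesis by (simp add: L2_set_def)
    qed
    have "bilin I x A y = bilin I x' A y' + bilin I (\<lambda>i. x i - x' i) A y + bilin I x' A (\<lambda>i. y i - y' i)"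
      by (simp add: bilin_diff_left bilin_diff_right)
    also have "bilin I x' A y' \<le> 10 * sqrt n"
    proof -
      have "bilin I x' A y' = (1 / s) * (1 / s) * bilin I (\<lambda>i. of_int (z i)) A (\<lambda>i. of_int (w i))"
        using bilin_scale[of I "1 / s" "\<lambda>i. of_int (z i)" A "1 / s" "\<lambda>i. of_int (w i)"]
        by (simp add: x'_def y'_def)
      also have "\<dots> \<le> (1 / s) * (1 / s) * (160 * n * sqrt n)"
        using net[OF z(1) w(1)] s by (intro mult_left_mono) (auto simp: n_def)
      also have "\<dots> = 10 * sqrt n" using s n by simp
      finally show ?thesis .
    qed
    also have "bilin I (\<lambda>i. x i - x' i) A y \<le> M * (1 / 4 * 1)"
    proof -
      have "bilin I (\<lambda>i. x i - x' i) A y \<le> M * (L2_set (\<lambda>i. x i - x' i) I * L2_set y I)" by (rule all)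
      also have "\<dots> \<le> M * (1 / 4 * 1)"
        using z(2) xy(3) M0 by (intro mult_left_mono mult_mono) (auto simp: x'_def L2_set_nonneg)
      finally show ?thesis .
    qed
    also have "bilin I x' A (\<lambda>i. y i - y' i) \<le> M * (1 * (1 / 4))"
    proof -
      have "bilin I x' A (\<lambda>i. y i - y' i) \<le> M * (L2_set x' I * L2_set (\<lambda>i. y i - y' i) I)" by (rule all)
      also have "\<dots> \<le> M * (1 * (1 / 4))"
        using w(2) x'1 M0 by (intro mult_left_mono mult_mono) (auto simp: y'_def L2_set_nonneg)
      finally show ?thesis .
    qed
    finally show ?case by (simp add: F_def xy M_def)
  qed (use P0 in auto)
  hence "M \<le> 20 * sqrt n" by simp
  hence "M * (L2_set x I * L2_set y I) \<le> 20 * sqrt n * (L2_set x I * L2_set y I)"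
    by (intro mult_right_mono) (auto simp: L2_set_nonneg)
  thus ?thesis using all[of x y] by (simp add: n_def)
qed

text \<open>These are finitely many linear conditions on A, so the event is measurable and open to a
  union bound; by \<open>bilin_le_of_lattice_net\<close> it forces a Euclidean operator norm of at
  most 20 sqrt n.\<close>

definition good_matrices :: "'i set \<Rightarrow> ('i \<times> 'i \<Rightarrow> real) set" where
  "good_matrices I = {A \<in> space (gauss (I \<times> I)). \<forall>z\<in>lattice_net I. \<forall>w\<in>lattice_net I.
     bilin I (\<lambda>i. of_int (z i)) A (\<lambda>i. of_int (w i)) \<le> 160 * real (card I) * sqrt (card I)}"

lemma measurable_bilin [measurable]: "(\<lambda>A. bilin I x A y) \<in> borel_measurable (gauss (I \<times> I))"
  unfolding bilin_eq_sum_Times gauss_def by measurable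

lemma sets_good_matrices: "finite I \<Longrightarrow> good_matrices I \<in> sets (gauss (I \<times> I))"
  unfolding good_matrices_def using finite_lattice_net[of I] by measurable

lemma measure_good_matrices:
  assumes "finite I" "I \<noteq> {}"
  shows "measure (gauss (I \<times> I)) (good_matrices I) \<ge> 14 / 15"
proof -
  interpret prob_space "gauss (I \<times> I)" by (rule prob_space_gauss)
  define n where "n = real (card I)"
  have n: "n \<ge> 1" using assms by (simp add: n_def Suc_le_eq card_gt_0_iff)
  define T where "T = 160 * n * sqrt n"
  define Bad where "Bad = (\<lambda>(z, w). {A \<in> space (gauss (I \<times> I)). bilin I (\<lambda>i. of_int (z i)) A (\<lambda>i. of_int (w i)) > T})"
  let ?N = "lattice_net I"
  have bad: "measure (gauss (I \<times> I)) (Bad p) \<le> exp (- 50 * n)" if p: "p \<in> ?N \<times> ?N" for p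
  proof -
    obtain z w where zw: "p = (z, w)" "z \<in> ?N" "w \<in> ?N" using p by auto
    have sq: "(\<Sum>i\<in>I. (real_of_int (z i))\<^sup>2) \<le> 16 * n" if "z \<in> ?N" for z :: "'a \<Rightarrow> int"
    proof -
      have "(\<Sum>i\<in>I. (z i)\<^sup>2) \<le> 16 * int (card I)" using that by (simp add: lattice_net_def)
      hence "real_of_int (\<Sum>i\<in>I. (z i)\<^sup>2) \<le> 16 * n" unfolding n_def by linarith
      thus ?thesis by simp
    qed
    \<comment> \<open>The minimiser of the Chernoff exponent t^2 (16 n)^2 / 2 - t T, whose two terms
      become 50 n and 100 n.\<close>
    define t where "t = 10 / (16 * sqrt n)"
    have t: "t > 0" "t\<^sup>2 * (16 * n * (16 * n)) = 100 * n" "t * T = 100 * n"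
      using n by (auto simp: t_def T_def power_divide power_mult_distrib field_simps)
    define c where "c e = t * (real_of_int (z (fst e)) * real_of_int (w (snd e)))" for e
    have "(\<Sum>e\<in>I \<times> I. (c e)\<^sup>2) = t\<^sup>2 * ((\<Sum>i\<in>I. (real_of_int (z i))\<^sup>2) * (\<Sum>i\<in>I. (real_of_int (w i))\<^sup>2))"
      unfolding c_def power_mult_distrib[of t] sum_distrib_left[symmetric]
      using sum_Times_mult_square[of "\<lambda>i. real_of_int (z i)" "\<lambda>i. real_of_int (w i)" I I] by simp
    also have "\<dots> \<le> t\<^sup>2 * (16 * n * (16 * n))"
      using sq[OF zw(2)] sq[OF zw(3)] n by (intro mult_left_mono mult_mono) (auto intro: sum_nonneg)
    also have "\<dots> = 100 * n" by (rule t)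
    finally have C: "(\<Sum>e\<in>I \<times> I. (c e)\<^sup>2) \<le> 100 * n" .
    have "Bad p = {A \<in> space (gauss (I \<times> I)). (\<Sum>e\<in>I \<times> I. c e * A e) > 100 * n}"
    proof -
      have "(\<Sum>e\<in>I \<times> I. c e * A e) = t * bilin I (\<lambda>i. of_int (z i)) A (\<lambda>i. of_int (w i))" for A
        unfolding bilin_eq_sum_Times c_def sum_distrib_left by (simp add: mult_ac)
      thus ?thesis using t(1) unfolding Bad_def zw(1) t(3)[symmetric] by simp
    qed
    hence "measure (gauss (I \<times> I)) (Bad p) \<le> exp ((\<Sum>e\<in>I \<times> I. (c e)\<^sup>2) / 2 - 100 * n)"
      using gauss_linear_tail[of "I \<times> I" "100 * n" c] assms by simp
    also have "\<dots> \<le> exp (- 50 * n)" using C by simp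
    finally show ?thesis .
  qed
  have finN: "finite (?N \<times> ?N)" using assms finite_lattice_net by blast
  have Bs: "Bad ` (?N \<times> ?N) \<subseteq> sets (gauss (I \<times> I))" unfolding Bad_def by auto
  have "measure (gauss (I \<times> I)) (\<Union>p\<in>?N \<times> ?N. Bad p) \<le> (\<Sum>p\<in>?N \<times> ?N. measure (gauss (I \<times> I)) (Bad p))"
    using finN Bs by (intro finite_measure_subadditive_finite) auto
  also have "\<dots> \<le> real (card (?N \<times> ?N)) * exp (- 50 * n)"
    using sum_mono[OF bad] by simp
  \<comment> \<open>At most 2^(36 n) <= exp (36 n) pairs, each with probability at most exp (- 50
    n), leave exp (- 14 n).\<close>
  also have "\<dots> \<le> (2 ^ (18 * card I) * 2 ^ (18 * card I)) * exp (- 50 * n)"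
    unfolding card_cartesian_product of_nat_mult
    using card_lattice_net[OF assms(1)] by (intro mult_right_mono mult_mono) auto
  also have "\<dots> \<le> exp (36 * n) * exp (- 50 * n)"
  proof (intro mult_right_mono)
    have "(2::real) ^ (18 * card I) * 2 ^ (18 * card I) = 2 ^ (36 * card I)" by (simp add: power_add[symmetric])
    also have "\<dots> \<le> exp 1 ^ (36 * card I)" using exp_ge_add_one_self[of 1] by (intro power_mono) auto
    also have "\<dots> = exp (36 * n)" by (simp add: exp_of_nat_mult[symmetric] n_def)
    finally show "(2::real) ^ (18 * card I) * 2 ^ (18 * card I) \<le> exp (36 * n)" .
  qed simp
  also have "\<dots> \<le> exp (- 14)" using n by (simp add: exp_add[symmetric])
  also have "\<dots> \<le> 1 / 15"
  proof -
    have "exp (14::real) \<ge> 15" using exp_ge_add_one_self[of 14] by simp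
    thus ?thesis by (simp add: exp_minus field_simps)
  qed
  finally have *: "measure (gauss (I \<times> I)) (\<Union>p\<in>?N \<times> ?N. Bad p) \<le> 1 / 15" .
  have "good_matrices I = space (gauss (I \<times> I)) - (\<Union>p\<in>?N \<times> ?N. Bad p)"
    unfolding good_matrices_def Bad_def T_def n_def by (auto simp flip: not_le)
  moreover have "(\<Union>p\<in>?N \<times> ?N. Bad p) \<in> sets (gauss (I \<times> I))"
    using finN Bs by (intro sets.finite_UN) auto
  ultimately have "measure (gauss (I \<times> I)) (good_matrices I) = 1 - measure (gauss (I \<times> I)) (\<Union>p\<in>?N \<times> ?N. Bad p)"
    by (simp add: prob_compl)
  thus ?thesis using * by simp
qed

section \<open>Projection to the rows of a sketch\<close>

text \<open>Gram-Schmidt, one row at a time: the residual \<open>d\<close> of the new row is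
  normalised and appended unless it vanishes. Dependent rows add nothing, so r may be smaller than
  k.\<close>

lemma orthonormal_span:
  fixes a :: "nat \<Rightarrow> 'i \<Rightarrow> real"
  assumes "finite I"
  obtains e :: "nat \<Rightarrow> 'i \<Rightarrow> real" and r where "r \<le> k"
    "\<And>s t. s < r \<Longrightarrow> t < r \<Longrightarrow> (\<Sum>i\<in>I. e s i * e t i) = (if s = t then 1 else 0)"
    "\<And>j i. j < k \<Longrightarrow> i \<in> I \<Longrightarrow> a j i = (\<Sum>s<r. (\<Sum>l\<in>I. a j l * e s l) * e s i)"
proof -
  define ip where "ip x y = (\<Sum>i\<in>I. x i * y i)" for x y :: "'i \<Rightarrow> real"
  have ip_comm: "ip x y = ip y x" for x y by (simp add: ip_def mult.commute)
  have ip_diff: "ip (\<lambda>i. x i - y i) z = ip x z - ip y z" for x y z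
    by (simp add: ip_def left_diff_distrib sum_subtractf)
  have ip_sum: "ip (\<lambda>i. \<Sum>s<r. c s * e s i) z = (\<Sum>s<r. c s * ip (e s) z)" for r :: nat and c e z
  proof -
    have "ip (\<lambda>i. \<Sum>s<r. c s * e s i) z = (\<Sum>i\<in>I. \<Sum>s<r. c s * (e s i * z i))"
      by (simp add: ip_def sum_distrib_right mult.assoc)
    also have "\<dots> = (\<Sum>s<r. \<Sum>i\<in>I. c s * (e s i * z i))" by (rule sum.swap)
    finally show ?thesis by (simp add: ip_def sum_distrib_left)
  qed
  have ip_scale: "ip x (\<lambda>i. y i / c) = ip x y / c" for x y c
    by (simp add: ip_def sum_divide_distrib)
  have "\<exists>e r. r \<le> k \<and> (\<forall>s<r. \<forall>t<r. ip (e s) (e t) = (if s = t then 1 else 0)) \<and>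
      (\<forall>j<k. \<forall>i\<in>I. a j i = (\<Sum>s<r. ip (a j) (e s) * e s i))"
  proof (induction k)
    case (Suc k)
    then obtain e r where e: "r \<le> k" "\<And>s t. s < r \<Longrightarrow> t < r \<Longrightarrow> ip (e s) (e t) = (if s = t then 1 else 0)"
      "\<And>j i. j < k \<Longrightarrow> i \<in> I \<Longrightarrow> a j i = (\<Sum>s<r. ip (a j) (e s) * e s i)" by blast
    define d where "d = (\<lambda>i. a k i - (\<Sum>s<r. ip (a k) (e s) * e s i))"
    have ip_d: "ip d z = ip (a k) z - (\<Sum>s<r. ip (a k) (e s) * ip (e s) z)" for z
      unfolding d_def ip_diff ip_sum ..
    have d_orth: "ip d (e t) = 0" if "t < r" for t
    proof -
      have "ip d (e t) = ip (a k) (e t) - (\<Sum>s<r. ip (a k) (e s) * ip (e s) (e t))"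
        by (rule ip_d)
      also have "(\<Sum>s<r. ip (a k) (e s) * ip (e s) (e t)) = (\<Sum>s<r. if s = t then ip (a k) (e s) else 0)"
        using e(2) that by (intro sum.cong) auto
      also have "\<dots> = ip (a k) (e t)" using that by simp
      finally show ?thesis by simp
    qed
    show ?case
    proof (cases "ip d d = 0")
      case True
      hence "d i = 0" if "i \<in> I" for i
        using that assms unfolding ip_def by (subst (asm) sum_nonneg_eq_0_iff) auto
      hence "\<forall>i\<in>I. a k i = (\<Sum>s<r. ip (a k) (e s) * e s i)" by (simp add: d_def)
      thus ?thesis using e by (intro exI[of _ e] exI[of _ r]) (auto simp: less_Suc_eq)
    next
      case False
      define N where "N = sqrt (ip d d)"
      have "ip d d \<ge> 0" unfolding ip_def by (intro sum_nonneg) auto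
      hence N: "N > 0" "N * N = ip d d" using False by (auto simp: N_def)
      define e' where "e' = e(r := (\<lambda>i. d i / N))"
      have e'_old: "e' s = e s" if "s < r" for s using that by (simp add: e'_def)
      have e'_r: "e' r = (\<lambda>i. d i / N)" by (simp add: e'_def)
      have rr: "ip (e' r) (e' r) = 1"
        
        unfolding e'_r ip_scale ip_comm[of "\<lambda>i. d i / N" d] using N False by (simp add: field_simps)
      have rs: "ip (e' r) (e' s) = 0" "ip (e' s) (e' r) = 0" if "s < r" for s

        using d_orth[OF that] ip_comm[of d "e s"]
        unfolding e'_r e'_old[OF that] ip_comm[of "\<lambda>i. d i / N" "e s"] ip_scale by simp_all
      have orth: "\<forall>s<Suc r. \<forall>t<Suc r. ip (e' s) (e' t) = (if s = t then 1 else 0)"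
        using e(2) rr rs by (auto simp: less_Suc_eq e'_old)
      \<comment> \<open>Row k differs from \<open>d\<close> by an element of the old span, to which
        \<open>d\<close> is orthogonal.\<close>
      have ad: "ip (a k) d = ip d d"
      proof -
        have "ip d d = ip (a k) d - (\<Sum>s<r. ip (a k) (e s) * ip (e s) d)"
          by (rule ip_d)
        also have "(\<Sum>s<r. ip (a k) (e s) * ip (e s) d) = 0"
          using d_orth ip_comm[of _ d] by (intro sum.neutral) auto
        finally show ?thesis by simp
      qed
      have "a j i = (\<Sum>s<Suc r. ip (a j) (e' s) * e' s i)" if j: "j < Suc k" and i: "i \<in> I" for j i
      proof (cases "j = k")
        case True
        have "(\<Sum>s<Suc r. ip (a k) (e' s) * e' s i) = (\<Sum>s<r. ip (a k) (e s) * e s i) + ip (a k) d / N * (d i / N)"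
          by (simp add: e'_old e'_r ip_scale)
        also have "ip (a k) d / N * (d i / N) = d i" unfolding ad N(2)[symmetric] using N(1) by simp
        finally show ?thesis using True by (simp add: d_def)
      next
        case False
        hence jk: "j < k" using j by simp
        \<comment> \<open>Earlier rows lie in the old span, so their coefficient on the new vector
          vanishes.\<close>
        have "ip (a j) d = ip (\<lambda>i. \<Sum>s<r. ip (a j) (e s) * e s i) d"
          unfolding ip_def[of _ d] by (intro sum.cong refl) (simp add: e(3)[OF jk])
        also have "\<dots> = (\<Sum>s<r. ip (a j) (e s) * ip (e s) d)"
          by (rule ip_sum)
        also have "\<dots> = 0" using d_orth ip_comm[of _ d] by (intro sum.neutral) auto
        finally show ?thesis using e(3)[OF jk i] by (simp add: e'_old e'_r ip_scale)
      qed
      thus ?thesis using e(1) orth by (intro exI[of _ e'] exI[of _ "Suc r"]) auto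
    qed
  qed auto
  thus ?thesis using that unfolding ip_def by blast
qed

lemma linear_maps_eq_sum:
  assumes "finite I" "L \<in> linear_maps I J" "x \<in> I \<rightarrow>\<^sub>E UNIV" "j \<in> J"
  shows "L x j = (\<Sum>i\<in>I. x i * L (\<lambda>l\<in>I. if l = i then 1 else 0) j)"
proof -
  let ?u = "\<lambda>i. \<lambda>l\<in>I. if l = i then 1 else (0::real)"
  have lin: "L (\<lambda>i\<in>I. a * x i + b * y i) j = a * L x j + b * L y j"
    if "x \<in> I \<rightarrow>\<^sub>E UNIV" "y \<in> I \<rightarrow>\<^sub>E UNIV" for x y a b
    using assms that unfolding linear_maps_def by blast
  have "L (\<lambda>l\<in>I. if l \<in> F then x l else 0) j = (\<Sum>i\<in>F. x i * L (?u i) j)" if "F \<subseteq> I" for F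
    using finite_subset[OF that assms(1)] that
  proof (induction F rule: finite_induct)
    case empty
    \<comment> \<open>Linearity with both coefficients zero shows that L maps the zero vector to
      zero.\<close>
    have "L (\<lambda>i\<in>I. 0 * x i + 0 * x i) j = 0 * L x j + 0 * L x j" by (rule lin) (use assms in auto)
    thus ?case by (simp add: restrict_def)
  next
    case (insert i F)
    have "L (\<lambda>l\<in>I. 1 * (\<lambda>l\<in>I. if l \<in> F then x l else 0) l + x i * ?u i l) j
        = 1 * L (\<lambda>l\<in>I. if l \<in> F then x l else 0) j + x i * L (?u i) j"
      by (rule lin) auto
    moreover have "(\<lambda>l\<in>I. 1 * (\<lambda>l\<in>I. if l \<in> F then x l else 0) l + x i * ?u i l)
        = (\<lambda>l\<in>I. if l \<in> insert i F then x l else 0)"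
      using insert.hyps by (auto simp: fun_eq_iff)
    ultimately show ?case using insert by (simp add: restrict_def)
  qed
  from this[of I] have "L (\<lambda>l\<in>I. if l \<in> I then x l else 0) j = (\<Sum>i\<in>I. x i * L (?u i) j)" by simp
  moreover have "(\<lambda>l\<in>I. if l \<in> I then x l else 0) = x"
    using assms(3) by (auto simp: fun_eq_iff PiE_def extensional_def)
  ultimately show ?thesis by simp
qed

lemma linear_maps_range:
  "L \<in> linear_maps I J \<Longrightarrow> x \<in> I \<rightarrow>\<^sub>E UNIV \<Longrightarrow> L x \<in> J \<rightarrow>\<^sub>E UNIV"
  unfolding linear_maps_def by auto

text \<open>L sees a vector only through inner products with its rows. The rows lie in the span of
  the \<open>e s\<close>, so x and its orthogonal projection to that span have the same inner
  products with them.\<close>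

lemma linear_maps_projection:
  assumes "finite I" "L \<in> linear_maps I {..<k}"
  obtains e :: "nat \<Rightarrow> 'i \<Rightarrow> real" and r where "r \<le> k"
    "\<And>s t. s < r \<Longrightarrow> t < r \<Longrightarrow> (\<Sum>i\<in>I. e s i * e t i) = (if s = t then 1 else 0)"
    "\<And>A x c. L (\<lambda>i\<in>I. A i + c * x i) = L (\<lambda>i\<in>I. A i + c * (\<Sum>s<r. (\<Sum>l\<in>I. e s l * x l) * e s i))"
proof -
  define a where "a j i = L (\<lambda>l\<in>I. if l = i then 1 else 0) j" for j i
  obtain e :: "nat \<Rightarrow> 'i \<Rightarrow> real" and r where e: "r \<le> k"
    "\<And>s t. s < r \<Longrightarrow> t < r \<Longrightarrow> (\<Sum>i\<in>I. e s i * e t i) = (if s = t then 1 else 0)"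
    "\<And>j i. j < k \<Longrightarrow> i \<in> I \<Longrightarrow> a j i = (\<Sum>s<r. (\<Sum>l\<in>I. a j l * e s l) * e s i)"
    by (rule orthonormal_span[OF assms(1), of k a]) (rule that; assumption)
  have "L (\<lambda>i\<in>I. A i + c * x i) = L (\<lambda>i\<in>I. A i + c * (\<Sum>s<r. (\<Sum>l\<in>I. e s l * x l) * e s i))" (is "?l = ?r") for A x c
  proof (rule PiE_ext)
    show "?l \<in> {..<k} \<rightarrow>\<^sub>E UNIV" "?r \<in> {..<k} \<rightarrow>\<^sub>E UNIV"
      by (rule linear_maps_range[OF assms(2)]; simp)+
    fix j assume j: "j \<in> {..<k}"
    have "(\<Sum>i\<in>I. x i * a j i) = (\<Sum>i\<in>I. \<Sum>s<r. x i * ((\<Sum>l\<in>I. a j l * e s l) * e s i))"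
      using j e(3) by (intro sum.cong refl) (simp add: sum_distrib_left)
    also have "\<dots> = (\<Sum>s<r. (\<Sum>i\<in>I. x i * e s i) * (\<Sum>l\<in>I. a j l * e s l))"
      unfolding sum.swap[of _ "{..<r}" I] by (simp add: sum_distrib_right mult_ac)
    also have "\<dots> = (\<Sum>s<r. \<Sum>l\<in>I. ((\<Sum>i\<in>I. e s i * x i) * e s l) * a j l)"
      by (simp add: sum_distrib_left mult_ac)
    also have "\<dots> = (\<Sum>l\<in>I. (\<Sum>s<r. (\<Sum>i\<in>I. e s i * x i) * e s l) * a j l)"
      by (subst sum.swap) (simp only: sum_distrib_right[symmetric])
    finally have eq: "(\<Sum>i\<in>I. x i * a j i) = (\<Sum>l\<in>I. (\<Sum>s<r. (\<Sum>i\<in>I. e s i * x i) * e s l) * a j l)" .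
    have "L (\<lambda>i\<in>I. A i + c * y i) j = (\<Sum>i\<in>I. A i * a j i) + c * (\<Sum>i\<in>I. y i * a j i)" for y
      using linear_maps_eq_sum[OF assms, of "\<lambda>i\<in>I. A i + c * y i" j] j
      by (simp add: a_def[symmetric] distrib_right sum.distrib mult.assoc sum_distrib_left)
    thus "?l j = ?r j" using eq by simp
  qed
  with e(1,2) that show ?thesis by blast
qed

section \<open>Indistinguishability of the hard instance\<close>

lemma sum_Times_outer_eq:
  "(\<Sum>e\<in>I \<times> J. M e * (u (fst e) * v (snd e))) = (\<Sum>j\<in>J. v j * (\<Sum>i\<in>I. u i * (M (i, j) :: real)))"
proof -
  have "(\<Sum>e\<in>I \<times> J. M e * (u (fst e) * v (snd e))) = (\<Sum>i\<in>I. \<Sum>j\<in>J. M (i, j) * (u i * v j))"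
    by (simp add: sum.cartesian_product case_prod_unfold)
  also have "\<dots> = (\<Sum>j\<in>J. \<Sum>i\<in>I. M (i, j) * (u i * v j))" by (rule sum.swap)
  finally show ?thesis by (simp add: sum_distrib_left mult_ac)
qed

text \<open>For fixed u the form is linear in v, so \<open>sum_sign_vectors_linear_square\<close>
  applies over v and then over u. Hence a linear functional of u v^T with unit coefficient norm has
  mean square one.\<close>

lemma sum_sign_pairs_bilinear_square:
  fixes M :: "'i \<times> 'i \<Rightarrow> real"
  assumes "finite I"
  shows "(\<Sum>p\<in>sign_vectors I \<times> sign_vectors I. (\<Sum>e\<in>I \<times> I. M e * (fst p (fst e) * snd p (snd e)))\<^sup>2)
    = 4 ^ card I * (\<Sum>e\<in>I \<times> I. (M e)\<^sup>2)"
proof -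
  have "(\<Sum>p\<in>sign_vectors I \<times> sign_vectors I. (\<Sum>e\<in>I \<times> I. M e * (fst p (fst e) * snd p (snd e)))\<^sup>2)
      = (\<Sum>u\<in>sign_vectors I. \<Sum>v\<in>sign_vectors I. (\<Sum>j\<in>I. v j * (\<Sum>i\<in>I. u i * M (i, j)))\<^sup>2)"
    unfolding sum_Times_outer_eq by (simp add: sum.cartesian_product case_prod_unfold)
  also have "\<dots> = (\<Sum>u\<in>sign_vectors I. 2 ^ card I * (\<Sum>j\<in>I. (\<Sum>i\<in>I. u i * M (i, j))\<^sup>2))"
    by (simp add: sum_sign_vectors_linear_square assms)
  also have "\<dots> = 2 ^ card I * (\<Sum>j\<in>I. \<Sum>u\<in>sign_vectors I. (\<Sum>i\<in>I. u i * M (i, j))\<^sup>2)"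
    by (subst sum.swap) (simp add: sum_distrib_left)
  also have "\<dots> = 2 ^ card I * (2 ^ card I * (\<Sum>j\<in>I. \<Sum>i\<in>I. (M (i, j))\<^sup>2))"
    by (simp add: sum_sign_vectors_linear_square assms sum_distrib_left)
  also have "(\<Sum>j\<in>I. \<Sum>i\<in>I. (M (i, j))\<^sup>2) = (\<Sum>e\<in>I \<times> I. (M e)\<^sup>2)"
    by (subst sum.swap) (simp add: sum.cartesian_product case_prod_unfold)
  finally show ?thesis by (simp add: power_mult_distrib[symmetric])
qed

text \<open>For fixed u the average over v is at most exp (|M^T u|^2 / 2), which is a quadratic
  chaos in u covered by \<open>sum_sign_vectors_exp_square\<close> with a = 1/2.\<close>

lemma sum_sign_pairs_exp_bilinear:
  fixes M :: "'i \<times> 'i \<Rightarrow> real"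
  assumes "finite I" "(\<Sum>e\<in>I \<times> I. (M e)\<^sup>2) \<le> 1 / 100"
  shows "(\<Sum>p\<in>sign_vectors I \<times> sign_vectors I. exp (\<Sum>e\<in>I \<times> I. M e * (fst p (fst e) * snd p (snd e))))
    \<le> 21 / 20 * 4 ^ card I"
proof -
  define F where "F = (\<Sum>i\<in>I. \<Sum>j\<in>I. (M (i, j))\<^sup>2)"
  have F: "0 \<le> F" "F \<le> 1 / 100"
    using assms(2) by (auto simp: F_def sum.cartesian_product case_prod_unfold intro: sum_nonneg)
  have "(\<Sum>p\<in>sign_vectors I \<times> sign_vectors I. exp (\<Sum>e\<in>I \<times> I. M e * (fst p (fst e) * snd p (snd e))))
      = (\<Sum>u\<in>sign_vectors I. \<Sum>v\<in>sign_vectors I. exp (\<Sum>j\<in>I. v j * (\<Sum>i\<in>I. u i * M (i, j))))"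
    unfolding sum_Times_outer_eq by (simp add: sum.cartesian_product case_prod_unfold)
  also have "\<dots> \<le> (\<Sum>u\<in>sign_vectors I. 2 ^ card I * exp ((\<Sum>j\<in>I. (\<Sum>i\<in>I. u i * M (i, j))\<^sup>2) / 2))"
    by (intro sum_mono sum_sign_vectors_exp_linear assms)
  also have "\<dots> = 2 ^ card I * (\<Sum>u\<in>sign_vectors I. exp (1 / 2 * (\<Sum>j\<in>I. (\<Sum>i\<in>I. u i * M (i, j))\<^sup>2)))"
    unfolding sum_distrib_left[of "2 ^ card I"] by simp
  also have "\<dots> \<le> 2 ^ card I * (2 ^ card I * exp (1 / 2 * F / (1 - 2 * (1 / 2) * F)))"
    using F sum_sign_vectors_exp_square[OF assms(1), where a = "1/2" and J = I and b = "\<lambda>i j. M (i, j)"]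
    unfolding F_def[symmetric] by (intro mult_left_mono) auto
  also have "\<dots> = 4 ^ card I * exp (1 / 2 * F / (1 - F))"
    by (simp add: power_mult_distrib[symmetric])
  also have "\<dots> \<le> 4 ^ card I * (21 / 20)"
  proof (intro mult_left_mono)
    \<comment> \<open>The value 1/21 is chosen because exp (- 1/21) >= 20/21 inverts to exp (1/21)
      <= 21/20.\<close>
    have "1 / 2 * F / (1 - F) \<le> 1 / 21" using F by (simp add: divide_le_eq)
    hence "exp (1 / 2 * F / (1 - F)) \<le> exp (1 / 21)" by simp
    also have "exp (1 / 21 :: real) \<le> 21 / 20"
    proof -
      have "exp (- (1 / 21) :: real) \<ge> 20 / 21" using exp_ge_add_one_self[of "- (1 / 21)"] by simp
      thus ?thesis by (simp add: exp_minus field_simps)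
    qed
    finally show "exp (1 / 2 * F / (1 - F)) \<le> 21 / 20" .
  qed simp
  finally show ?thesis by simp
qed

lemma sum_projection_mult:
  fixes e :: "nat \<Rightarrow> 'i \<Rightarrow> real" and x y :: "'i \<Rightarrow> real"
  assumes "\<And>s t. s < r \<Longrightarrow> t < r \<Longrightarrow> (\<Sum>i\<in>I. e s i * e t i) = (if s = t then 1 else 0)"
  defines "Z \<equiv> \<lambda>x i. \<Sum>s<r. (\<Sum>l\<in>I. e s l * x l) * e s i"
  shows "(\<Sum>i\<in>I. Z x i * y i) = (\<Sum>s<r. (\<Sum>l\<in>I. e s l * x l) * (\<Sum>l\<in>I. e s l * y l))"
    and "(\<Sum>i\<in>I. Z x i * Z y i) = (\<Sum>i\<in>I. Z x i * y i)"
proof -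
  have 1: "(\<Sum>i\<in>I. Z x i * y i) = (\<Sum>s<r. (\<Sum>l\<in>I. e s l * x l) * (\<Sum>l\<in>I. e s l * y l))" for x y
  proof -
    have "(\<Sum>i\<in>I. Z x i * y i) = (\<Sum>i\<in>I. \<Sum>s<r. (\<Sum>l\<in>I. e s l * x l) * (e s i * y i))"
      unfolding Z_def by (simp only: sum_distrib_right[of _ "{..<r}"] mult.assoc)
    also have "\<dots> = (\<Sum>s<r. \<Sum>i\<in>I. (\<Sum>l\<in>I. e s l * x l) * (e s i * y i))" by (rule sum.swap)
    finally show ?thesis by (simp only: sum_distrib_left)
  qed
  show "(\<Sum>i\<in>I. Z x i * y i) = (\<Sum>s<r. (\<Sum>l\<in>I. e s l * x l) * (\<Sum>l\<in>I. e s l * y l))" by (rule 1)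
  have eZ: "(\<Sum>l\<in>I. e t l * Z y l) = (\<Sum>l\<in>I. e t l * y l)" if "t < r" for t
  proof -
    have "(\<Sum>l\<in>I. e t l * Z y l) = (\<Sum>l\<in>I. Z y l * e t l)" by (simp add: mult.commute)
    also have "\<dots> = (\<Sum>s<r. (\<Sum>l\<in>I. e s l * y l) * (\<Sum>l\<in>I. e s l * e t l))" by (rule 1)
    also have "\<dots> = (\<Sum>s<r. if s = t then (\<Sum>l\<in>I. e s l * y l) else 0)"
      using assms(1) that by (intro sum.cong) auto
    finally show ?thesis using that by simp
  qed
  show "(\<Sum>i\<in>I. Z x i * Z y i) = (\<Sum>i\<in>I. Z x i * y i)"
    unfolding 1 using eZ by (intro sum.cong) auto
qed

text \<open>For a fixed sketch the perturbations act through their projections, and the mixture of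
  these shifts is compared with the unshifted Gaussian by
  \<open>gauss_mixture_indistinguishable\<close>.\<close>

lemma sketch_indistinguishable:
  fixes L :: "('i \<times> 'i \<Rightarrow> real) \<Rightarrow> nat \<Rightarrow> real" and g :: "(nat \<Rightarrow> real) \<Rightarrow> real"
  assumes "finite I" "L \<in> linear_maps (I \<times> I) {..<k}"
    and small: "1000 * \<sigma> ^ 4 * real k \<le> 1"
    and g: "(\<lambda>A. g (L A)) \<in> borel_measurable (gauss (I \<times> I))" "\<And>y. 0 \<le> g y" "\<And>y. g y \<le> 1"
  shows "(\<integral>A. g (L A) \<partial>gauss (I \<times> I)) \<le> 1 / 2 +
    (\<Sum>p\<in>sign_vectors I \<times> sign_vectors I.
      \<integral>A. g (L (\<lambda>e\<in>I \<times> I. A e + \<sigma> * (fst p (fst e) * snd p (snd e)))) \<partial>gauss (I \<times> I)) / 4 ^ card I"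
proof -
  define U where "U = sign_vectors I \<times> sign_vectors I"
  have U: "finite U" "card U = 4 ^ card I"
    unfolding U_def using assms(1)
    by (auto simp: finite_sign_vectors card_sign_vectors power_mult_distrib[symmetric])
  hence Une: "U \<noteq> {}" by auto
  obtain r and b :: "nat \<Rightarrow> 'i \<times> 'i \<Rightarrow> real" where b: "r \<le> k"
    "\<And>s t. s < r \<Longrightarrow> t < r \<Longrightarrow> (\<Sum>i\<in>I \<times> I. b s i * b t i) = (if s = t then 1 else 0)"
    "\<And>A x c. L (\<lambda>i\<in>I \<times> I. A i + c * x i) = L (\<lambda>i\<in>I \<times> I. A i + c * (\<Sum>s<r. (\<Sum>l\<in>I \<times> I. b s l * x l) * b s i))"
    by (rule linear_maps_projection[OF finite_cartesian_product[OF assms(1,1)] assms(2)]) (rule that; assumption)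
  define X where "X p e = fst p (fst e) * snd p (snd e)" for p :: "('i \<Rightarrow> real) \<times> ('i \<Rightarrow> real)" and e
  define Z where "Z x i = (\<Sum>s<r. (\<Sum>l\<in>I \<times> I. b s l * x l) * b s i)" for x i
  \<comment> \<open>The squared Frobenius norm of \<open>\<sigma>\<^sup>2 * Z (X p)\<close>, the
    matrix of the chaos in the second moment. The set \<open>E\<close> keeps the pairs to which
    \<open>sum_sign_pairs_exp_bilinear\<close> applies.\<close>
  define Q where "Q p = \<sigma> ^ 4 * (\<Sum>e\<in>I \<times> I. (Z (X p) e)\<^sup>2)" for p
  define E where "E = {p \<in> U. Q p \<le> 1 / 100}"
  have Zmult: "(\<Sum>i\<in>I \<times> I. Z x i * y i) = (\<Sum>s<r. (\<Sum>l\<in>I \<times> I. b s l * x l) * (\<Sum>l\<in>I \<times> I. b s l * y l))"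
    "(\<Sum>i\<in>I \<times> I. Z x i * Z y i) = (\<Sum>i\<in>I \<times> I. Z x i * y i)" for x y
    unfolding Z_def by (rule sum_projection_mult; use b(2) in blast)+
  have Q0: "Q p \<ge> 0" for p unfolding Q_def by (intro mult_nonneg_nonneg sum_nonneg) auto
  have "(\<Sum>p\<in>U. Q p) = \<sigma> ^ 4 * (\<Sum>p\<in>U. \<Sum>s<r. (\<Sum>l\<in>I \<times> I. b s l * X p l)\<^sup>2)"
    unfolding Q_def sum_distrib_left[symmetric] power2_eq_square Zmult(2) unfolding Zmult(1) ..
  also have "(\<Sum>p\<in>U. \<Sum>s<r. (\<Sum>l\<in>I \<times> I. b s l * X p l)\<^sup>2) = (\<Sum>s<r. \<Sum>p\<in>U. (\<Sum>l\<in>I \<times> I. b s l * X p l)\<^sup>2)"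
    by (rule sum.swap)
  also have "\<dots> = (\<Sum>s<r. 4 ^ card I)"
  proof (intro sum.cong refl)
    fix s assume "s \<in> {..<r}"
    thus "(\<Sum>p\<in>U. (\<Sum>l\<in>I \<times> I. b s l * X p l)\<^sup>2) = 4 ^ card I"
      using b(2)[of s s] unfolding U_def X_def sum_sign_pairs_bilinear_square[OF assms(1)]
      by (simp add: power2_eq_square)
  qed
  also have "\<sigma> ^ 4 * (\<Sum>s<r. 4 ^ card I) = (\<sigma> ^ 4 * real r) * real (card U)" by (simp add: U)
  also have "\<dots> \<le> 1 / 1000 * real (card U)"
  proof (intro mult_right_mono)
    have "\<sigma> ^ 4 * real r \<le> \<sigma> ^ 4 * real k" using b(1) by (intro mult_left_mono) auto
    thus "\<sigma> ^ 4 * real r \<le> 1 / 1000" using small by simp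
  qed simp
  finally have sumQ: "(\<Sum>p\<in>U. Q p) \<le> 1 / 1000 * real (card U)" .
  have EU: "E \<subseteq> U" by (auto simp: E_def)
  \<comment> \<open>Markov's inequality: Q averages at most 1/1000 and exceeds 1/100 off E, so at
    most a tenth of the pairs is lost.\<close>
  have cardE: "9 * card U \<le> 10 * card E"
  proof -
    have "real (card (U - E)) * (1 / 100) = (\<Sum>p\<in>U - E. 1 / 100)" by simp
    also have "\<dots> \<le> (\<Sum>p\<in>U - E. Q p)" by (intro sum_mono) (auto simp: E_def)
    also have "\<dots> \<le> (\<Sum>p\<in>U. Q p)" using U Q0 by (intro sum_mono2) auto
    also note sumQ
    finally have "10 * real (card (U - E)) \<le> real (card U)" by simp
    moreover have "real (card (U - E)) = real (card U) - real (card E)"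
      using EU U(1) card_mono[OF U(1) EU] by (simp add: card_Diff_subset finite_subset of_nat_diff)
    ultimately show ?thesis by linarith
  qed
  define w where "w p e = \<sigma> * Z (X p) e" for p e
  have "(\<Sum>p\<in>E. \<Sum>q\<in>E. exp (\<Sum>e\<in>I \<times> I. w p e * w q e)) \<le> (\<Sum>p\<in>E. 21 / 20 * real (card U))"
  proof (intro sum_mono)
    fix p assume p: "p \<in> E"
    \<comment> \<open>Only one projection is kept, so that the exponent is bilinear in the two sign
      vectors of q.\<close>
    have eq: "(\<Sum>e\<in>I \<times> I. w p e * w q e) = (\<Sum>e\<in>I \<times> I. (\<sigma>\<^sup>2 * Z (X p) e) * X q e)" for q
    proof -
      have "(\<Sum>e\<in>I \<times> I. w p e * w q e) = \<sigma>\<^sup>2 * (\<Sum>e\<in>I \<times> I. Z (X p) e * Z (X q) e)"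
        by (simp add: w_def sum_distrib_left power2_eq_square mult_ac)
      thus ?thesis unfolding Zmult(2) by (simp add: sum_distrib_left mult.assoc)
    qed
    \<comment> \<open>Only the inner sum is enlarged to all of U; p stays in E, where Q p <=
      1/100.\<close>
    have "(\<Sum>q\<in>E. exp (\<Sum>e\<in>I \<times> I. w p e * w q e)) \<le> (\<Sum>q\<in>U. exp (\<Sum>e\<in>I \<times> I. w p e * w q e))"
      using U EU by (intro sum_mono2) auto
    also have "\<dots> \<le> 21 / 20 * 4 ^ card I"
      unfolding eq U_def unfolding X_def[of q for q]
    proof (rule sum_sign_pairs_exp_bilinear[OF assms(1)])
      have "(\<Sum>e\<in>I \<times> I. (\<sigma>\<^sup>2 * Z (X p) e)\<^sup>2) = Q p"
        unfolding Q_def power_mult_distrib sum_distrib_left[symmetric] by simp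
      thus "(\<Sum>e\<in>I \<times> I. (\<sigma>\<^sup>2 * Z (\<lambda>e. fst p (fst e) * snd p (snd e)) e)\<^sup>2) \<le> 1 / 100"
        using p by (simp add: E_def X_def[abs_def])
    qed
    finally show "(\<Sum>q\<in>E. exp (\<Sum>e\<in>I \<times> I. w p e * w q e)) \<le> 21 / 20 * real (card U)" by (simp add: U)
  qed
  also have "\<dots> = real (card E) * (21 / 20 * real (card U))" by simp
  also have "\<dots> \<le> real (card U) * (21 / 20 * real (card U))"
    using card_mono[OF U(1) EU] by (intro mult_right_mono) auto
  finally have sm: "(\<Sum>p\<in>E. \<Sum>q\<in>E. exp (\<Sum>e\<in>I \<times> I. w p e * w q e)) \<le> 21 / 20 * (real (card U))\<^sup>2"
    by (simp add: power2_eq_square)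
  have Lw: "L (\<lambda>e\<in>I \<times> I. A e + w p e) = L (\<lambda>e\<in>I \<times> I. A e + \<sigma> * X p e)" for p A
    unfolding w_def Z_def by (rule b(3)[symmetric])
  have "(\<integral>A. g (L A) \<partial>gauss (I \<times> I)) \<le> 1 / 2 + (\<Sum>p\<in>U. \<integral>A. g (L (\<lambda>e\<in>I \<times> I. A e + w p e)) \<partial>gauss (I \<times> I)) / card U"
    by (rule gauss_mixture_indistinguishable[OF _ U(1) EU Une cardE sm g]) (use assms(1) in auto)
  thus ?thesis unfolding Lw U(2) unfolding U_def X_def by simp
qed

section \<open>The lower bound\<close>

lemma op_norm_good_matrix_le:
  assumes "n \<ge> 1" "q \<ge> 2" "1 \<le> p" "p \<le> 2" "A \<in> good_matrices {..<n}"
  shows "op_norm q p n A \<le> 20 * sqrt n * (lp_norm p {..<n} (\<lambda>_. 1) / lp_norm q {..<n} (\<lambda>_. 1))"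
proof (rule op_norm_le[OF assms(1-4)])
  show "bilin {..<n} y A x \<le> 20 * sqrt n * (L2_set y {..<n} * L2_set x {..<n})" for x y
    using bilin_le_of_lattice_net[of "{..<n}" A y x] assms(1,5)
    by (auto simp: good_matrices_def lessThan_empty_iff)
qed simp

text \<open>The form is tested at u and v: the perturbation contributes \<open>\<sigma>\<close> n^2
  and the good matrix at least - 20 n sqrt n.\<close>

lemma op_norm_perturbed_good_matrix_ge:
  assumes "n \<ge> 1" "q \<ge> 2" "1 \<le> p" "p \<le> 2" "A \<in> good_matrices {..<n}"
    and u: "u \<in> sign_vectors {..<n}" and v: "v \<in> sign_vectors {..<n}"
  shows "(\<sigma> * n - 20 * sqrt n) * (lp_norm p {..<n} (\<lambda>_. 1) / lp_norm q {..<n} (\<lambda>_. 1))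
    \<le> op_norm q p n (\<lambda>e\<in>{..<n} \<times> {..<n}. A e + \<sigma> * (u (fst e) * v (snd e)))"
proof -
  let ?I = "{..<n}" and ?A = "\<lambda>e\<in>{..<n} \<times> {..<n}. A e + \<sigma> * (u (fst e) * v (snd e))"
  have I: "finite ?I" "?I \<noteq> {}" using assms(1) by (auto simp: lessThan_empty_iff)
  have L2: "L2_set w ?I = sqrt n" if "w \<in> sign_vectors ?I" for w
    using sign_vectors_square[OF that] by (simp add: L2_set_def power2_eq_square)
  \<comment> \<open>The bound for good matrices is one-sided; applied at - u it becomes a lower
    bound.\<close>
  have "bilin ?I (\<lambda>i. - 1 * u i) A (\<lambda>i. 1 * v i) \<le> 20 * sqrt n * (L2_set (\<lambda>i. - 1 * u i) ?I * L2_set (\<lambda>i. 1 * v i) ?I)"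
    using bilin_le_of_lattice_net[OF I, of A "\<lambda>i. - 1 * u i" "\<lambda>i. 1 * v i"] assms(5)
    by (auto simp: good_matrices_def)
  hence lo: "- (20 * sqrt n * n) \<le> bilin ?I u A v"
    unfolding bilin_scale L2_set_scale L2[OF u] L2[OF v] by simp
  have "bilin ?I u ?A v = bilin ?I u A v + (\<Sum>i<n. \<Sum>j<n. \<sigma> * ((u i * u i) * (v j * v j)))"
    unfolding bilin_def sum.distrib[symmetric]
    by (intro sum.cong refl) (simp add: algebra_simps)
  also have "(\<Sum>i<n. \<Sum>j<n. \<sigma> * ((u i * u i) * (v j * v j))) = \<sigma> * n * n"
    using sign_vectors_square[OF u] sign_vectors_square[OF v] by simp
  finally have eq: "bilin ?I u ?A v = bilin ?I u A v + \<sigma> * n * n" .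
  have "(\<sigma> * n - 20 * sqrt n) * n \<le> bilin ?I u ?A v" unfolding eq using lo by (simp add: algebra_simps)
  hence "\<sigma> * n - 20 * sqrt n \<le> bilin ?I u ?A v / n" using assms(1) by (simp add: le_divide_eq)
  hence "(\<sigma> * n - 20 * sqrt n) * (lp_norm p ?I (\<lambda>_. 1) / lp_norm q ?I (\<lambda>_. 1))
      \<le> bilin ?I u ?A v / n * (lp_norm p ?I (\<lambda>_. 1) / lp_norm q ?I (\<lambda>_. 1))"
    using lp_norm_nonneg[OF I] by (intro mult_right_mono divide_nonneg_nonneg) auto
  also have "\<dots> \<le> op_norm q p n ?A" by (rule op_norm_ge_bilin_sign[OF assms(1-4) u v])
  finally show ?thesis .
qed

text \<open>This serves to show that perturbed matrices are nonzero, since the accuracy of a sketch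
  is promised only for nonzero ones.\<close>

lemma op_norm_zero_le:
  assumes "n \<ge> 1" "q \<ge> 2" "1 \<le> p" "p \<le> 2" "\<And>i j. i < n \<Longrightarrow> j < n \<Longrightarrow> A (i, j) = 0"
  shows "op_norm q p n A \<le> 0"
  using op_norm_le[OF assms(1-4), of 0 A] assms(5) by (simp add: bilin_def)

section \<open>Joint measurability of sketch and matrix, and the null set of the zero matrix\<close>

lemma space_linear_map_borel: "space (linear_map_borel I J) = linear_maps I J"
  unfolding linear_map_borel_def space_restrict_space
  by (auto simp: space_PiM linear_maps_def)

text \<open>Both the map and its argument vary, so evaluation is no coordinate projection. Expanded
  in unit vectors it is a finite sum of products of measurable coordinates, as Fubini's theorem will
  require.\<close>

lemma measurable_linear_map_eval:
  assumes "finite I" and [measurable_cong]: "sets P = sets (linear_map_borel I J)"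
  shows "(\<lambda>(A, L). L A) \<in> measurable (gauss I \<Otimes>\<^sub>M P) (\<Pi>\<^sub>M j\<in>J. borel)"
proof -
  have spP: "space P = linear_maps I J"
    using sets_eq_imp_space_eq[OF assms(2)] by (simp add: space_linear_map_borel)
  let ?u = "\<lambda>i. \<lambda>l\<in>I. if l = i then 1 else (0::real)"
  have coord [measurable]: "(\<lambda>L. L (?u i) j) \<in> borel_measurable P" if "j \<in> J" for i j
  proof -
    have "(\<lambda>L. L (?u i)) \<in> measurable (linear_map_borel I J) (\<Pi>\<^sub>M j\<in>J. borel)"
      unfolding linear_map_borel_def
      by (intro measurable_restrict_space1 measurable_component_singleton) auto
    hence "(\<lambda>L. L (?u i) j) \<in> borel_measurable (linear_map_borel I J)"
      by (rule measurable_compose) (rule measurable_component_singleton[OF that])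
    thus ?thesis by (simp cong: measurable_cong_sets[OF assms(2) refl])
  qed
  have "(\<lambda>x. \<lambda>j\<in>J. \<Sum>i\<in>I. fst x i * snd x (?u i) j) \<in> measurable (gauss I \<Otimes>\<^sub>M P) (\<Pi>\<^sub>M j\<in>J. borel)"
  proof (intro measurable_restrict borel_measurable_sum borel_measurable_times)
    fix i j assume ij: "i \<in> I" "j \<in> J"
    show "(\<lambda>x. fst x i) \<in> borel_measurable (gauss I \<Otimes>\<^sub>M P)"
      using ij unfolding gauss_def by measurable
    show "(\<lambda>x. snd x (?u i) j) \<in> borel_measurable (gauss I \<Otimes>\<^sub>M P)"
      by (rule measurable_compose[OF measurable_snd coord[OF ij(2)]])
  qed
  also have "?this \<longleftrightarrow> ?thesis"
  proof (rule measurable_cong)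
    fix x assume x: "x \<in> space (gauss I \<Otimes>\<^sub>M P)"
    obtain A L where AL: "x = (A, L)" "A \<in> I \<rightarrow>\<^sub>E UNIV" "L \<in> linear_maps I J"
      using x by (auto simp: space_pair_measure space_gauss spP)
    have "L A = (\<lambda>j\<in>J. \<Sum>i\<in>I. A i * L (?u i) j)"
      using linear_maps_range[OF AL(3,2)] linear_maps_eq_sum[OF assms(1) AL(3,2)]
      by (auto simp: PiE_iff extensional_def fun_eq_iff)
    thus "(\<lambda>j\<in>J. \<Sum>i\<in>I. fst x i * snd x (?u i) j) = (case x of (A, L) \<Rightarrow> L A)" by (simp add: AL(1))
  qed
  finally show ?thesis .
qed

text \<open>One normal coordinate already has no atom at 0. The zero matrix, which the accuracy
  requirement excludes, can thus be discarded.\<close>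

lemma measure_gauss_zero:
  assumes "finite I" "I \<noteq> {}"
  shows "measure (gauss I) (I \<rightarrow>\<^sub>E {0}) = 0"
proof -
  interpret product_sigma_finite "\<lambda>_. std_normal"
    by (intro product_sigma_finite.intro prob_space_imp_sigma_finite prob_space_std_normal)
  have "emeasure std_normal {0} = (\<integral>\<^sup>+x. ennreal (std_normal_density x) * indicator {0} x \<partial>lborel)"
    unfolding std_normal_def by (subst emeasure_density) auto
  also have "\<dots> = 0"
    by (subst nn_integral_indicator_singleton) auto
  finally have "emeasure std_normal {0} = 0" .
  hence "emeasure (gauss I) (I \<rightarrow>\<^sub>E {0}) = 0"
    unfolding gauss_def using assms by (subst emeasure_PiM) auto
  thus ?thesis by (simp add: measure_def)
qed

text \<open>The test \<open>f (L A) < T\<close> accepts a Gaussian matrix with probability at least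
  5/6 times 14/15, that is 7/9, and a perturbed one with probability at most 1/6 + 1/15 = 7/30.
  Indistinguishability would allow at most 1/2 + 7/30 = 11/15 < 7/9 for the former.\<close>

lemma sketching_family_lower_bound:
  fixes p q :: ereal
  assumes n: "n \<ge> 1" and pq: "q \<ge> 2" "1 \<le> p" "p \<le> 2" and \<gamma>: "\<gamma> > 1"
    and sk: "sketching_family q p n k \<gamma> P f"
    and small: "1000 * (20 * (1 + \<gamma>\<^sup>2) / sqrt n) ^ 4 * real k \<le> 1"
  shows False
proof -
  let ?I = "{..<n}" and ?II = "{..<n} \<times> {..<n}"
  define \<sigma> where "\<sigma> = 20 * (1 + \<gamma>\<^sup>2) / sqrt n"
  define \<beta> where "\<beta> = lp_norm p ?I (\<lambda>_. 1) / lp_norm q ?I (\<lambda>_. 1)"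
  \<comment> \<open>The threshold is \<open>\<gamma>\<close> times the norm bound for good matrices;
    \<open>\<sigma>\<close> is chosen so that the lower bound after perturbation equals
    \<open>\<gamma> * T\<close>.\<close>
  define T where "T = \<gamma> * (20 * sqrt n * \<beta>)"
  have I: "finite ?I" "?I \<noteq> {}" using n by (auto simp: lessThan_empty_iff)
  have \<beta>: "\<beta> > 0" unfolding \<beta>_def by (intro divide_pos_pos lp_norm_one_pos I)
  interpret P: prob_space P using sk by (simp add: sketching_family_def)
  interpret G: prob_space "gauss ?II" by (rule prob_space_gauss)
  interpret GP: pair_prob_space "gauss ?II" P ..
  have setsP: "sets P = sets (linear_map_borel ?II {..<k})"
    and f [measurable]: "f \<in> borel_measurable (\<Pi>\<^sub>M i\<in>{..<k}. borel)"
    and acc: "\<And>A. A \<in> ?II \<rightarrow>\<^sub>E UNIV \<Longrightarrow> \<exists>i<n. \<exists>j<n. A (i, j) \<noteq> 0 \<Longrightarrow>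
      P.prob {L \<in> space P. f (L A) \<in> {1 / \<gamma> * op_norm q p n A <..< \<gamma> * op_norm q p n A}} \<ge> 5 / 6"
    using sk by (auto simp: sketching_family_def)
  have spP: "space P = linear_maps ?II {..<k}"
    using sets_eq_imp_space_eq[OF setsP] by (simp add: space_linear_map_borel)
  define g where "g y = (if f y < T then 1 else 0 :: real)" for y
  have g01: "0 \<le> g y" "g y \<le> 1" for y by (auto simp: g_def)
  have gm [measurable]: "g \<in> borel_measurable (\<Pi>\<^sub>M i\<in>{..<k}. borel)" unfolding g_def by measurable
  have ev: "(\<lambda>(A, L). L A) \<in> measurable (gauss ?II \<Otimes>\<^sub>M P) (\<Pi>\<^sub>M j\<in>{..<k}. borel)"
    using I by (intro measurable_linear_map_eval setsP) auto
  define W where "W w = (\<lambda>A. \<lambda>e\<in>?II. A e + w e)" for w :: "nat \<times> nat \<Rightarrow> real"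
  have Wm [measurable]: "W w \<in> measurable (gauss ?II) (gauss ?II)" for w
    unfolding W_def by (rule measurable_gauss_add)
  have Wsp: "W w A \<in> ?II \<rightarrow>\<^sub>E UNIV" for w A by (simp add: W_def)
  have evW: "(\<lambda>(A, L). L (W w A)) \<in> measurable (gauss ?II \<Otimes>\<^sub>M P) (\<Pi>\<^sub>M j\<in>{..<k}. borel)" for w
  proof -
    have "(\<lambda>(A, L). (W w A, L)) \<in> measurable (gauss ?II \<Otimes>\<^sub>M P) (gauss ?II \<Otimes>\<^sub>M P)" by measurable
    from measurable_compose[OF this ev] show ?thesis by (simp add: case_prod_unfold)
  qed
  have int: "integrable (gauss ?II \<Otimes>\<^sub>M P) (\<lambda>(A, L). g (L (W w A)))" for w
    using measurable_compose[OF evW gm, of w] g01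
    by (intro GP.P.integrable_const_bound[of _ 1]) (auto simp: case_prod_unfold)
  \<comment> \<open>\<open>Y\<close> averages over sketches at a fixed matrix, where accuracy
    applies; \<open>X\<close> averages over Gaussian matrices at a fixed sketch, where
    \<open>sketch_indistinguishable\<close> applies. Fubini's theorem links the two.\<close>
  define Y where "Y w A = (\<integral>L. g (L (W w A)) \<partial>P)" for w A
  define X where "X w L = (\<integral>A. g (L (W w A)) \<partial>gauss ?II)" for w L
  have XY: "(\<integral>L. X w L \<partial>P) = (\<integral>A. Y w A \<partial>gauss ?II)" for w
    unfolding X_def Y_def using GP.Fubini_integral[OF int[of w]] .
  have Xint: "integrable P (X w)" for w
    unfolding X_def using GP.integrable_snd[OF int[of w]] by simp
  have Yint: "integrable (gauss ?II) (Y w)" for w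
    unfolding Y_def using GP.integrable_fst[OF int[of w]] by simp
  have evm: "{L \<in> space P. f (L A) < T} \<in> sets P" "{L \<in> space P. f (L A) \<in> {a<..<b}} \<in> sets P"
    if "A \<in> ?II \<rightarrow>\<^sub>E UNIV" for A a b
  proof -
    have "(\<lambda>L. L A) \<in> measurable P (\<Pi>\<^sub>M j\<in>{..<k}. borel)"
      using measurable_compose[OF measurable_Pair1'[of A "gauss ?II" P] ev] that
      by (simp add: space_gauss)
    note [measurable] = measurable_compose[OF this f]
    show "{L \<in> space P. f (L A) < T} \<in> sets P" "{L \<in> space P. f (L A) \<in> {a<..<b}} \<in> sets P"
      by measurable
  qed
  have Yprob: "Y w A = P.prob {L \<in> space P. f (L (W w A)) < T}" for w A
  proof -
    have "Y w A = (\<integral>L. indicator {L \<in> space P. f (L (W w A)) < T} L \<partial>P)"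
      unfolding Y_def by (intro Bochner_Integration.integral_cong) (auto simp: g_def indicator_def)
    thus ?thesis using evm[OF Wsp] by simp
  qed
  define D where "D = good_matrices ?I - (?II \<rightarrow>\<^sub>E {0})"
  have zs: "(?II \<rightarrow>\<^sub>E {0::real}) \<in> sets (gauss ?II)"
    unfolding gauss_def using I by (intro sets_PiM_I_finite) auto
  have gs: "good_matrices ?I \<in> sets (gauss ?II)" by (rule sets_good_matrices[OF I(1)])
  have Ds: "D \<in> sets (gauss ?II)" unfolding D_def using zs gs by auto
  have muD: "G.prob D \<ge> 14 / 15"
  proof -
    have "G.prob (good_matrices ?I) \<le> G.prob (D \<union> (?II \<rightarrow>\<^sub>E {0}))"
      by (intro G.finite_measure_mono sets.Un Ds zs) (auto simp: D_def)
    also have "\<dots> \<le> G.prob D + G.prob (?II \<rightarrow>\<^sub>E {0})"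
      by (rule measure_Un_le[OF Ds zs])
    also have "G.prob (?II \<rightarrow>\<^sub>E {0}) = 0" using I by (intro measure_gauss_zero) auto
    finally show ?thesis using measure_good_matrices[OF I] by simp
  qed
  have null: "5 / 6 * G.prob D \<le> (\<integral>A. Y (\<lambda>_. 0) A \<partial>gauss ?II)"
  proof -
    have "5 / 6 * G.prob D = (\<integral>A. 5 / 6 * indicator D A \<partial>gauss ?II)" using Ds by simp
    also have "\<dots> \<le> (\<integral>A. Y (\<lambda>_. 0) A \<partial>gauss ?II)"
    proof (intro integral_mono Yint)
      fix A assume A: "A \<in> space (gauss ?II)"
      have WA: "W (\<lambda>_. 0) A = A" using A by (auto simp: W_def space_gauss PiE_def extensional_def fun_eq_iff)
      show "5 / 6 * indicator D A \<le> Y (\<lambda>_. 0) A"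
      proof (cases "A \<in> D")
        case True
        hence good: "A \<in> good_matrices ?I" and nz: "A \<notin> ?II \<rightarrow>\<^sub>E {0}" by (auto simp: D_def)
        have "\<exists>i<n. \<exists>j<n. A (i, j) \<noteq> 0" 
        proof (rule ccontr)
          assume "\<not> ?thesis"
          hence "A \<in> ?II \<rightarrow>\<^sub>E {0}"
            using A by (intro PiE_I) (auto simp: space_gauss PiE_def extensional_def)
          thus False using nz by contradiction
        qed
        hence "5 / 6 \<le> P.prob {L \<in> space P. f (L A) \<in> {1 / \<gamma> * op_norm q p n A <..< \<gamma> * op_norm q p n A}}"
          using A by (intro acc) (auto simp: space_gauss)
        also have "\<dots> \<le> P.prob {L \<in> space P. f (L A) < T}"
        proof (rule P.finite_measure_mono)
          have "\<gamma> * op_norm q p n A \<le> T"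
            unfolding T_def \<beta>_def using op_norm_good_matrix_le[OF n pq good] \<gamma> by (intro mult_left_mono) auto
          thus "{L \<in> space P. f (L A) \<in> {1 / \<gamma> * op_norm q p n A <..< \<gamma> * op_norm q p n A}} \<subseteq> {L \<in> space P. f (L A) < T}"
            by auto
        qed (use evm A in \<open>simp add: space_gauss\<close>)
        finally show ?thesis using True by (simp add: Yprob WA)
      qed (simp add: Yprob)
    qed (use Ds in \<open>auto simp: G.emeasure_eq_measure\<close>)
    finally show ?thesis .
  qed
  \<comment> \<open>On \<open>D\<close> accuracy bounds the acceptance probability by 1/6; off
    \<open>D\<close> the trivial bound 1 is used.\<close>
  have alt: "(\<integral>A. Y (\<lambda>e. \<sigma> * (fst z (fst e) * snd z (snd e))) A \<partial>gauss ?II) \<le> 1 / 6 + (1 - G.prob D)"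
    if z: "z \<in> sign_vectors ?I \<times> sign_vectors ?I" for z
  proof -
    define w where "w e = \<sigma> * (fst z (fst e) * snd z (snd e))" for e
    have "(\<integral>A. Y w A \<partial>gauss ?II) \<le> (\<integral>A. 1 / 6 + indicator (space (gauss ?II) - D) A \<partial>gauss ?II)"
    proof (intro integral_mono Yint)
      fix A assume A: "A \<in> space (gauss ?II)"
      show "Y w A \<le> 1 / 6 + indicator (space (gauss ?II) - D) A"
      proof (cases "A \<in> D")
        case True
        let ?A = "W w A"
        have "(\<sigma> * n - 20 * sqrt n) * \<beta> \<le> op_norm q p n ?A"
          unfolding W_def w_def \<beta>_def using True z
          by (intro op_norm_perturbed_good_matrix_ge[OF n pq]) (auto simp: D_def)
        moreover have "(\<sigma> * n - 20 * sqrt n) * \<beta> = \<gamma> * T"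
        proof -
          have "real n / sqrt n = sqrt n" by (rule real_div_sqrt) simp
          hence "\<sigma> * n = 20 * (1 + \<gamma>\<^sup>2) * sqrt n" unfolding \<sigma>_def by (metis times_divide_eq_left times_divide_eq_right)
          thus ?thesis by (simp add: T_def algebra_simps power2_eq_square)
        qed
        ultimately have ge: "\<gamma> * T \<le> op_norm q p n ?A" by simp
        have Tpos: "T > 0" unfolding T_def using \<gamma> \<beta> n by (intro mult_pos_pos) auto
        have "\<gamma> * T > 0" using Tpos \<gamma> by simp
        have "\<exists>i<n. \<exists>j<n. ?A (i, j) \<noteq> 0"
        proof (rule ccontr)
          assume "\<not> ?thesis"
          hence "op_norm q p n ?A \<le> 0" by (intro op_norm_zero_le[OF n pq]) auto
          thus False using ge \<open>\<gamma> * T > 0\<close> by simp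
        qed
        hence "5 / 6 \<le> P.prob {L \<in> space P. f (L ?A) \<in> {1 / \<gamma> * op_norm q p n ?A <..< \<gamma> * op_norm q p n ?A}}"
          by (intro acc Wsp)
        also have "\<dots> \<le> P.prob (space P - {L \<in> space P. f (L ?A) < T})"
        proof (rule P.finite_measure_mono)
          have "T \<le> 1 / \<gamma> * op_norm q p n ?A" using ge \<gamma> by (simp add: le_divide_eq mult.commute)
          thus "{L \<in> space P. f (L ?A) \<in> {1 / \<gamma> * op_norm q p n ?A <..< \<gamma> * op_norm q p n ?A}} \<subseteq> space P - {L \<in> space P. f (L ?A) < T}"
            by auto
        qed (use evm[OF Wsp] in auto)
        also have "\<dots> = 1 - Y w A" unfolding Yprob by (rule P.prob_compl[OF evm(1)[OF Wsp]])
        finally have "Y w A \<le> 1 / 6" by simp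
        thus ?thesis by (auto simp: indicator_def)
      next
        case False
        hence "indicator (space (gauss ?II) - D) A = (1::real)" using A by simp
        moreover have "Y w A \<le> 1" by (simp add: Yprob)
        ultimately show ?thesis by linarith
      qed
    qed (use Ds in \<open>auto simp: G.emeasure_eq_measure\<close>)
    also have "\<dots> = 1 / 6 + (1 - G.prob D)"
      using Ds by (subst Bochner_Integration.integral_add) (auto simp: G.emeasure_eq_measure G.prob_compl G.prob_space)
    finally show ?thesis by (simp add: w_def[abs_def])
  qed
  let ?U = "sign_vectors ?I \<times> sign_vectors ?I"
  let ?w = "\<lambda>z e. \<sigma> * (fst z (fst e) * snd z (snd e))"
  have cardU: "card ?U = 4 ^ n"
    using I by (simp add: card_sign_vectors card_cartesian_product power_mult_distrib[symmetric])
  have "(\<integral>L. X (\<lambda>_. 0) L \<partial>P) \<le> (\<integral>L. 1 / 2 + (\<Sum>z\<in>?U. X (?w z) L) / 4 ^ n \<partial>P)"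
  proof (intro integral_mono Xint)
    fix L assume L: "L \<in> space P"
    have gL: "(\<lambda>A. g (L A)) \<in> borel_measurable (gauss ?II)"
      using measurable_compose[OF measurable_Pair2'[OF L] measurable_compose[OF ev gm]] by simp
    have "X (\<lambda>_. 0) L = (\<integral>A. g (L A) \<partial>gauss ?II)"
      unfolding X_def
      by (intro Bochner_Integration.integral_cong refl arg_cong[of _ _ "\<lambda>A. g (L A)"])
         (auto simp: W_def space_gauss PiE_def extensional_def fun_eq_iff)
    also have "\<dots> \<le> 1 / 2 + (\<Sum>z\<in>?U. X (?w z) L) / 4 ^ n"
      using sketch_indistinguishable[OF I(1) L[unfolded spP] small[folded \<sigma>_def] gL g01]
      unfolding X_def W_def by (simp only: card_lessThan)
    finally show "X (\<lambda>_. 0) L \<le> 1 / 2 + (\<Sum>z\<in>?U. X (?w z) L) / 4 ^ n" .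
  qed (intro Bochner_Integration.integrable_add integrable_divide Bochner_Integration.integrable_sum Xint P.integrable_const)
  also have "\<dots> = 1 / 2 + (\<Sum>z\<in>?U. \<integral>L. X (?w z) L \<partial>P) / 4 ^ n"
    using Xint by (simp add: P.prob_space)
  also have "\<dots> \<le> 1 / 2 + (\<Sum>z\<in>?U. 1 / 6 + (1 - G.prob D)) / 4 ^ n"
    unfolding XY by (intro add_left_mono divide_right_mono sum_mono alt) auto
  also have "\<dots> = 1 / 2 + (1 / 6 + (1 - G.prob D))" using cardU by simp
  finally show False using null muD unfolding XY by simp
qed

theorem theorem4p8:
  fixes p q :: ereal and \<gamma> :: real and k :: "nat \<Rightarrow> nat"
    and S :: "nat \<Rightarrow> ((nat \<times> nat \<Rightarrow> real) \<Rightarrow> nat \<Rightarrow> real) measure"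
    and f :: "nat \<Rightarrow> (nat \<Rightarrow> real) \<Rightarrow> real"
  assumes "q \<ge> 2" and "1 \<le> p" and "p \<le> 2" and "\<gamma> > 1"
    and "\<And>n. n \<ge> 1 \<Longrightarrow> sketching_family q p n (k n) \<gamma> (S n) (f n)"
  shows "(\<lambda>n. real (k n)) \<in> \<Omega>(\<lambda>n. real n ^ 2)"
proof -
  \<comment> \<open>As (sqrt n)^4 = n^2, the bound k <= c n^2 is the smallness hypothesis of
    \<open>sketching_family_lower_bound\<close>.\<close>
  define c where "c = 1 / (1000 * (20 * (1 + \<gamma>\<^sup>2)) ^ 4)"
  have C: "20 * (1 + \<gamma>\<^sup>2) > 0" by (smt (verit) zero_le_power2)
  have c: "c > 0" using C by (simp add: c_def)
  have "real (k n) \<ge> c * real n ^ 2" if n: "n \<ge> 1" for n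
  proof (rule ccontr)
    assume "\<not> ?thesis"
    hence "real (k n) \<le> c * real n ^ 2" by simp
    moreover have "(sqrt n) ^ 4 = real n ^ 2"
      using power_mult[of "sqrt n" 2 2] by simp
    ultimately have "1000 * (20 * (1 + \<gamma>\<^sup>2) / sqrt n) ^ 4 * real (k n) \<le> 1"
      using n C by (simp add: c_def power_divide divide_simps mult_ac)
    thus False by (rule sketching_family_lower_bound[OF n assms(1-4) assms(5)[OF n]])
  qed
  hence "eventually (\<lambda>n. c * norm (real n ^ 2) \<le> norm (real (k n))) at_top"
    by (intro eventually_at_top_linorderI[of 1]) auto
  thus ?thesis using c by (intro landau_omega.bigI) auto
qed

end
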